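(* Let $G$ be a Fuchsian group of the first kind with a cusp at $\infty$, and let $H$ be any finite index subgroup of $G$, with $[G:H]=m$. If $\rho:H\to\mathrm{GL}_d(\mathbb{C})$ is a rank $d$ admissible representation of $H$, then the induced representation $\widetilde\rho=\mathrm{Ind}_H^G(\rho)$ of $G$, of rank $dm$, is also an admissible representation.
   Context: $\mathrm{PSL}_2(\mathbb{R})$ acts by Möbius transformations on the upper half plane $\mathbb{H}$ and on $\mathbb{R}\cup\{\infty\}$. A Fuchsian group of the first kind is a discrete subgroup $G\subset\mathrm{PSL}_2(\mathbb{R})$ having a fundamental domain in $\mathbb{H}$ of finite hyperbolic area. A cusp of $G$ is a point of $\mathbb{R}\cup\{\infty\}$ fixed by a nontrivial parabolic element of $G$. Generators of cusp stabilizers: write $t^{h}=\pm\begin{pmatrix}1&h\\0&1\end{pmatrix}$. The stabilizer of the cusp $\infty$ in $G$ is infinite cyclic, generated by $t_\infty=t^{h_\infty}$ for a unique positive real number $h_\infty$. For a cusp $\mathfrak{c}\in\mathbb{R}$ put $A_{\mathfrak{c}}=\pm\begin{pmatrix}\mathfrak{c}&-1\\1&0\end{pmatrix}$, so $A_{\mathfrak{c}}(\infty)=\mathfrak{c}$; the stabilizer of $\mathfrak{c}$ in $G$ is infinite cyclic, generated by $t_{\mathfrak{c}}=A_{\mathfrak{c}}t^{h_{\mathfrak{c}}}A_{\mathfrak{c}}^{-1}$, where $h_{\mathfrak{c}}$ is the smallest positive real number for which this element lies in $G$. The same definitions are used for $H$. Admissible representation: a representation $\rho:G\to\mathrm{GL}_d(\mathbb{C})$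 of a Fuchsian group of the first kind with a cusp at $\infty$ is admissible if (1) $\rho(t_\infty)$ is a diagonal matrix, and (2) $\rho(t_{\mathfrak{c}})$ is a diagonalizable matrix for every cusp $\mathfrak{c}\neq\infty$ in a set of representatives of the $G$-inequivalent cusps. Induced representation: write $G=\gamma_1H\cup\cdots\cup\gamma_mH$ (disjoint), with $\gamma_1=1$, and extend $\rho$ to a function on $G$ by $\rho(x)=0$ for $x\notin H$. Then $\widetilde\rho(x)$ is the $dm\times dm$ matrix whose $(i,j)$ block of size $d\times d$ is $\rho(\gamma_i^{-1}x\gamma_j)$. Different choices of coset representatives give equivalent representations.
   Formalization: Admissibility of the induced representation is stated up to equivalence: some representation conjugate to it by one fixed matrix is admissible. Literally the claim fails: for PSL2(Z), Γ_0(2) and trivial ρ, the induced matrix at t_∞ is a nontrivial permutation matrix. *)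

theory Defs
  imports
    "HOL-Analysis.Analysis"
    "HOL-Algebra.Algebra"
    "HOL-Algebra.Left_Coset"
    "Jordan_Normal_Form.Matrix"
begin

no_notation Matrix.vec_index (infixl \<open>$\<close> 100)

section \<open>The group PSL(2,R)\<close>

definition SL2R :: "(real^2^2) monoid" where
  "SL2R = \<lparr>carrier = {A. Determinants.det A = 1}, mult = (**), one = Finite_Cartesian_Product.mat 1\<rparr>"

text \<open>As a factor group, an element of PSL(2,R) is a coset, that is a two-element set
  \<open>{A, - A}\<close>.\<close>

definition PSL2R :: "(real^2^2) set monoid" where
  "PSL2R = SL2R Mod {Finite_Cartesian_Product.mat 1, - Finite_Cartesian_Product.mat 1}"

definition pm :: "real^2^2 \<Rightarrow> (real^2^2) set" where
  "pm A = {A, - A}"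

definition mat2 :: "real \<Rightarrow> real \<Rightarrow> real \<Rightarrow> real \<Rightarrow> real^2^2" where
  "mat2 a b c d = vector [vector [a, b], vector [c, d]]"

abbreviation subgrp :: "(real^2^2) set set \<Rightarrow> (real^2^2) set monoid" where
  "subgrp G \<equiv> PSL2R\<lparr>carrier := G\<rparr>"

text \<open>The quotient topology along \<open>A \<mapsto> \<plusminus>A\<close>, see \<open>quotient_map_pm\<close> below.\<close>

definition PSL2R_topology :: "(real^2^2) set topology" where
  "PSL2R_topology = topology (\<lambda>U. U \<subseteq> carrier PSL2R \<and>
     openin (top_of_set (carrier SL2R)) {A \<in> carrier SL2R. pm A \<in> U})"

definition discrete_subgroup :: "(real^2^2) set set \<Rightarrow> bool" where
  "discrete_subgroup G \<longleftrightarrow>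
     subgroup G PSL2R \<and> subtopology PSL2R_topology G = discrete_topology G"


section \<open>Moebius transformations\<close>

text \<open>The actions below do not depend on the representative chosen, since \<open>A\<close> and \<open>- A\<close> act
  alike.\<close>

definition some_matrix :: "(real^2^2) set \<Rightarrow> real^2^2" where
  "some_matrix g = (SOME A. A \<in> g)"

definition upper_half_plane :: "complex set" where
  "upper_half_plane = {z. Im z > 0}"

definition act_H :: "(real^2^2) set \<Rightarrow> complex \<Rightarrow> complex" where
  "act_H g = (let A = some_matrix g in
     moebius (of_real (A$1$1)) (of_real (A$1$2)) (of_real (A$2$1)) (of_real (A$2$2)))"

datatype bdpoint = Fin real | Infty

fun mat_act_bd :: "real^2^2 \<Rightarrow> bdpoint \<Rightarrow> bdpoint" where
  "mat_act_bd A Infty = (if A$2$1 = 0 then Infty else Fin (A$1$1 / A$2$1))"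
| "mat_act_bd A (Fin x) = (if A$2$1 * x + A$2$2 = 0 then Infty
     else Fin ((A$1$1 * x + A$1$2) / (A$2$1 * x + A$2$2)))"

definition act_bd :: "(real^2^2) set \<Rightarrow> bdpoint \<Rightarrow> bdpoint" where
  "act_bd g = mat_act_bd (some_matrix g)"


section \<open>Fuchsian groups of the first kind\<close>

definition hyperbolic_area :: "complex set \<Rightarrow> ennreal" where
  "hyperbolic_area F = (\<integral>\<^sup>+ z\<in>F. ennreal (1 / (Im z)\<^sup>2) \<partial>lborel)"

text \<open>A fundamental domain is a region that is closed in the upper half plane, namely the relative
  closure of its interior, whose translates cover the upper half plane and have disjoint
  interiors.\<close>

definition fundamental_domain :: "(real^2^2) set set \<Rightarrow> complex set \<Rightarrow> bool" where
  "fundamental_domain G F \<longleftrightarrow>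
     F = upper_half_plane \<inter> closure (interior F) \<and>
     (\<Union>g\<in>G. act_H g ` F) = upper_half_plane \<and>
     (\<forall>g\<in>G. g \<noteq> \<one>\<^bsub>PSL2R\<^esub> \<longrightarrow> act_H g ` interior F \<inter> interior F = {})"

definition fuchsian_first_kind :: "(real^2^2) set set \<Rightarrow> bool" where
  "fuchsian_first_kind G \<longleftrightarrow>
     discrete_subgroup G \<and> (\<exists>F. fundamental_domain G F \<and> hyperbolic_area F < \<infinity>)"


section \<open>Cusps and generators of their stabilizers\<close>

definition parabolic :: "(real^2^2) set \<Rightarrow> bool" where
  "parabolic g \<longleftrightarrow> g \<in> carrier PSL2R \<and> g \<noteq> \<one>\<^bsub>PSL2R\<^esub> \<and> \<bar>trace (some_matrix g)\<bar> = 2"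

definition is_cusp :: "(real^2^2) set set \<Rightarrow> bdpoint \<Rightarrow> bool" where
  "is_cusp G c \<longleftrightarrow> (\<exists>g\<in>G. parabolic g \<and> act_bd g c = c)"

definition cusp_representatives :: "(real^2^2) set set \<Rightarrow> bdpoint set \<Rightarrow> bool" where
  "cusp_representatives G R \<longleftrightarrow>
     (\<forall>r\<in>R. is_cusp G r) \<and>
     (\<forall>c. is_cusp G c \<longrightarrow> (\<exists>!r. r \<in> R \<and> r \<in> orbit (subgrp G) act_bd c))"

definition transl :: "real \<Rightarrow> (real^2^2) set" where
  "transl h = pm (mat2 1 h 0 1)"

definition cusp_transl :: "real \<Rightarrow> real \<Rightarrow> (real^2^2) set" where
  "cusp_transl c h = pm (mat2 c (- 1) 1 0) \<otimes>\<^bsub>PSL2R\<^esub> transl h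
     \<otimes>\<^bsub>PSL2R\<^esub> inv\<^bsub>PSL2R\<^esub> (pm (mat2 c (- 1) 1 0))"

fun cusp_width :: "(real^2^2) set set \<Rightarrow> bdpoint \<Rightarrow> real" where
  "cusp_width G Infty =
     (THE h. h > 0 \<and> stabilizer (subgrp G) act_bd Infty = generate PSL2R {transl h})"
| "cusp_width G (Fin c) = (LEAST h. h > 0 \<and> cusp_transl c h \<in> G)"

fun cusp_generator :: "(real^2^2) set set \<Rightarrow> bdpoint \<Rightarrow> (real^2^2) set" where
  "cusp_generator G Infty = transl (cusp_width G Infty)"
| "cusp_generator G (Fin c) = cusp_transl c (cusp_width G (Fin c))"


section \<open>Representations\<close>

definition GLC :: "nat \<Rightarrow> complex mat monoid" where
  "GLC n = units_of (ring_mat TYPE(complex) n ())"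

definition representation ::
  "(real^2^2) set set \<Rightarrow> nat \<Rightarrow> ((real^2^2) set \<Rightarrow> complex mat) \<Rightarrow> bool" where
  "representation G n \<rho> \<longleftrightarrow> \<rho> \<in> hom (subgrp G) (GLC n)"

definition equivalent_representations ::
  "(real^2^2) set set \<Rightarrow> ((real^2^2) set \<Rightarrow> complex mat) \<Rightarrow> ((real^2^2) set \<Rightarrow> complex mat) \<Rightarrow> bool"
  where
  "equivalent_representations G \<rho> \<sigma> \<longleftrightarrow> (\<exists>P Q. \<forall>x\<in>G. similar_mat_wit (\<rho> x) (\<sigma> x) P Q)"

definition diagonalizable_mat :: "complex mat \<Rightarrow> bool" where
  "diagonalizable_mat A \<longleftrightarrow> (\<exists>D. diagonal_mat D \<and> similar_mat A D)"

text \<open>Here \<open>R\<close> is the set of representatives of the \<open>G\<close>-inequivalent cusps.\<close>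

definition admissible ::
  "(real^2^2) set set \<Rightarrow> bdpoint set \<Rightarrow> nat \<Rightarrow> ((real^2^2) set \<Rightarrow> complex mat) \<Rightarrow> bool" where
  "admissible G R n \<rho> \<longleftrightarrow>
     representation G n \<rho> \<and>
     diagonal_mat (\<rho> (cusp_generator G Infty)) \<and>
     (\<forall>c\<in>R. c \<noteq> Infty \<longrightarrow> diagonalizable_mat (\<rho> (cusp_generator G c)))"


section \<open>Induced representations\<close>

definition left_transversal ::
  "(real^2^2) set set \<Rightarrow> (real^2^2) set set \<Rightarrow> nat \<Rightarrow> (nat \<Rightarrow> (real^2^2) set) \<Rightarrow> bool" where
  "left_transversal G H m \<gamma> \<longleftrightarrow>
     (\<forall>i<m. \<gamma> i \<in> G) \<and> \<gamma> 0 = \<one>\<^bsub>PSL2R\<^esub> \<and>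
     (\<Union>i<m. \<gamma> i <#\<^bsub>PSL2R\<^esub> H) = G \<and>
     disjoint_family_on (\<lambda>i. \<gamma> i <#\<^bsub>PSL2R\<^esub> H) {..<m}"

text \<open>The entry in row \<open>i * d + a\<close> and column \<open>j * d + b\<close>, where \<open>a, b < d\<close>, is the
  \<open>(a, b)\<close> entry of the block \<open>(i, j)\<close>. Indices count from 0, so that \<open>\<gamma> 0\<close> represents the
  coset \<open>H\<close>.\<close>

definition induced_representation ::
  "(real^2^2) set set \<Rightarrow> nat \<Rightarrow> nat \<Rightarrow> (nat \<Rightarrow> (real^2^2) set) \<Rightarrow>
   ((real^2^2) set \<Rightarrow> complex mat) \<Rightarrow> (real^2^2) set \<Rightarrow> complex mat" where
  "induced_representation H d m \<gamma> \<rho> x =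
     (let \<rho>0 = (\<lambda>y. if y \<in> H then \<rho> y else 0\<^sub>m d d) in
      Matrix.mat (d * m) (d * m) (\<lambda>(r, s).
        \<rho>0 (inv\<^bsub>PSL2R\<^esub> (\<gamma> (r div d)) \<otimes>\<^bsub>PSL2R\<^esub> x \<otimes>\<^bsub>PSL2R\<^esub> \<gamma> (s div d)) $$ (r mod d, s mod d)))"


section \<open>Basic facts\<close>

lemma group_SL2R: "Group.group SL2R"
proof (rule groupI)
  fix x assume "x \<in> carrier SL2R"
  then have d: "Determinants.det x = 1" by (simp add: SL2R_def)
  then have "invertible x" by (simp add: invertible_det_nz)
  then obtain y where y: "y ** x = Finite_Cartesian_Product.mat 1"
    by (auto simp: invertible_def)
  then have "Determinants.det y * Determinants.det x = 1"
    by (metis det_I det_mul)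
  with d y show "\<exists>y\<in>carrier SL2R. y \<otimes>\<^bsub>SL2R\<^esub> x = \<one>\<^bsub>SL2R\<^esub>"
    by (auto simp: SL2R_def)
qed (auto simp: SL2R_def det_mul matrix_mul_assoc)

lemma det_uminus_2: "Determinants.det (- A :: real^2^2) = Determinants.det A"
  by (simp add: det_2)

lemma normal_center: "{Finite_Cartesian_Product.mat 1, - Finite_Cartesian_Product.mat 1} \<lhd> SL2R"
proof -
  have n: "- A ** B = - (A ** B)" "A ** - B = - (A ** B)" for A B :: "real^2^2"
    by (simp_all add: matrix_matrix_mult_def Finite_Cartesian_Product.vec_eq_iff sum_negf)
  interpret Group.group SL2R by (rule group_SL2R)
  have *: "subgroup {Finite_Cartesian_Product.mat 1, - Finite_Cartesian_Product.mat 1} SL2R"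
  proof (rule subgroupI)
    fix a assume a: "a \<in> {Finite_Cartesian_Product.mat 1, - Finite_Cartesian_Product.mat 1 :: real^2^2}"
    then have "inv\<^bsub>SL2R\<^esub> a = a"
      by (intro inv_equality) (auto simp: SL2R_def n det_uminus_2)
    with a show "inv\<^bsub>SL2R\<^esub> a \<in> {Finite_Cartesian_Product.mat 1, - Finite_Cartesian_Product.mat 1}"
      by simp
  qed (auto simp: SL2R_def n det_uminus_2)
  show ?thesis
    unfolding normal_inv_iff
  proof (intro conjI ballI *)
    fix x h assume x: "x \<in> carrier SL2R"
      and h: "h \<in> {Finite_Cartesian_Product.mat 1, - Finite_Cartesian_Product.mat 1 :: real^2^2}"
    have "x \<otimes>\<^bsub>SL2R\<^esub> h = h \<otimes>\<^bsub>SL2R\<^esub> x" using h by (auto simp: SL2R_def n)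
    moreover have "h \<in> carrier SL2R" using h by (auto simp: SL2R_def det_uminus_2)
    ultimately have "x \<otimes>\<^bsub>SL2R\<^esub> h \<otimes>\<^bsub>SL2R\<^esub> inv\<^bsub>SL2R\<^esub> x = h" using x
      by (simp add: m_assoc)
    with h show "x \<otimes>\<^bsub>SL2R\<^esub> h \<otimes>\<^bsub>SL2R\<^esub> inv\<^bsub>SL2R\<^esub> x
        \<in> {Finite_Cartesian_Product.mat 1, - Finite_Cartesian_Product.mat 1}" by simp
  qed
qed

lemma group_PSL2R: "Group.group PSL2R"
  unfolding PSL2R_def by (rule normal.factorgroup_is_group[OF normal_center])

lemma carrier_PSL2R: "carrier PSL2R = pm ` carrier SL2R"
proof -
  have "- Finite_Cartesian_Product.mat 1 ** A = - A" for A :: "real^2^2"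
    using matrix_mul_lid[of A] by (simp add: matrix_matrix_mult_def Finite_Cartesian_Product.vec_eq_iff sum_negf)
  then show ?thesis
    by (auto simp: PSL2R_def FactGroup_def RCOSETS_def r_coset_def pm_def SL2R_def)
qed

lemma openin_PSL2R_topology:
  "openin PSL2R_topology U \<longleftrightarrow> U \<subseteq> carrier PSL2R \<and>
     openin (top_of_set (carrier SL2R)) {A \<in> carrier SL2R. pm A \<in> U}"
proof -
  have "istopology (\<lambda>U. U \<subseteq> carrier PSL2R \<and>
     openin (top_of_set (carrier SL2R)) {A \<in> carrier SL2R. pm A \<in> U})"
    unfolding istopology_def
  proof (intro conjI allI impI)
    fix S T
    assume "S \<subseteq> carrier PSL2R \<and> openin (top_of_set (carrier SL2R)) {A \<in> carrier SL2R. pm A \<in> S}"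
      "T \<subseteq> carrier PSL2R \<and> openin (top_of_set (carrier SL2R)) {A \<in> carrier SL2R. pm A \<in> T}"
    moreover have "{A \<in> carrier SL2R. pm A \<in> S \<inter> T}
        = {A \<in> carrier SL2R. pm A \<in> S} \<inter> {A \<in> carrier SL2R. pm A \<in> T}" by auto
    ultimately show "S \<inter> T \<subseteq> carrier PSL2R"
      "openin (top_of_set (carrier SL2R)) {A \<in> carrier SL2R. pm A \<in> S \<inter> T}"
      by (auto simp: openin_Int)
  next
    fix K
    assume K: "\<forall>S\<in>K. S \<subseteq> carrier PSL2R \<and>
      openin (top_of_set (carrier SL2R)) {A \<in> carrier SL2R. pm A \<in> S}"
    have "{A \<in> carrier SL2R. pm A \<in> \<Union> K} = (\<Union>S\<in>K. {A \<in> carrier SL2R. pm A \<in> S})" by auto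
    with K show "openin (top_of_set (carrier SL2R)) {A \<in> carrier SL2R. pm A \<in> \<Union> K}"
      by (simp only:) (rule openin_Union, auto)
    show "\<Union> K \<subseteq> carrier PSL2R" using K by auto
  qed
  then show ?thesis by (simp add: PSL2R_topology_def)
qed

lemma quotient_map_pm: "quotient_map (top_of_set (carrier SL2R)) PSL2R_topology pm"
proof -
  have "{A \<in> carrier SL2R. pm A \<in> carrier PSL2R} = carrier SL2R"
    by (auto simp: carrier_PSL2R)
  then have "openin PSL2R_topology (carrier PSL2R)"
    by (simp add: openin_PSL2R_topology)
  moreover have "topspace PSL2R_topology \<subseteq> carrier PSL2R"
    by (metis openin_PSL2R_topology openin_topspace)
  ultimately have "topspace PSL2R_topology = carrier PSL2R"
    by (metis openin_subset subset_antisym)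
  then show ?thesis
    by (auto simp: quotient_map_def openin_PSL2R_topology carrier_PSL2R)
qed

end

theory Submission
  imports Defs "Jordan_Normal_Form.Jordan_Normal_Form_Existence"
begin

text \<open>The representing matrix of the generator \<open>t\<close> of a cusp stabilizer of \<open>G\<close> under the induced
  representation \<open>\<rho>'\<close> permutes the blocks, so it is rarely block diagonal itself. A suitable
  power \<open>t\<^sup>N\<close> is better: since \<open>H\<close> has finite index, \<open>N > 0\<close> can be chosen such that
  \<open>\<gamma>\<^sub>i\<^sup>-\<^sup>1 t\<^sup>N \<gamma>\<^sub>i\<close> lies in \<open>H\<close> for every coset representative \<open>\<gamma>\<^sub>i\<close>
  (\<open>common_power_conjugate_in_subgroup\<close>), and then \<open>\<rho>'(t\<^sup>N)\<close> is block diagonal with the blocks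
  \<open>\<rho>(\<gamma>\<^sub>i\<^sup>-\<^sup>1 t\<^sup>N \<gamma>\<^sub>i)\<close> (\<open>induced_block_diag\<close>).

  Each \<open>\<gamma>\<^sub>i\<^sup>-\<^sup>1 t\<^sup>N \<gamma>\<^sub>i\<close> is a parabolic element of \<open>H\<close> fixing the boundary point
  \<open>\<gamma>\<^sub>i\<^sup>-\<^sup>1 c\<close>, which is therefore a cusp of \<open>H\<close> and is carried by some element of \<open>H\<close> to one of the
  chosen representatives \<open>r\<close>. Conjugation by that element turns the parabolic element into a positive
  power of the generator at \<open>r\<close> (\<open>cusp_elt_conjugate\<close>, \<open>cusp_generator\<close>), whose matrix is
  diagonalizable because \<open>\<rho>\<close> is admissible (\<open>admissible_diagonalizable_cusp_elt\<close>). Hence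
  \<open>\<rho>'(t)\<^sup>N\<close> is diagonalizable, and an invertible complex matrix with a diagonalizable positive power
  is itself diagonalizable (\<open>diagonalizable_if_power_diagonalizable\<close>).

  This applies to all cusps of \<open>G\<close>. It remains to pass to the equivalent representation \<open>\<sigma>\<close>
  obtained by conjugating \<open>\<rho>'\<close> with a matrix that diagonalizes the value at the generator for
  infinity: \<open>\<sigma>\<close> satisfies the stronger condition at infinity and is still diagonalizable at the
  other cusps.\<close>

section \<open>Diagonalizable powers of complex matrices\<close>

lemma jordan_matrix_entry:
  assumes "i < sum_list (map fst n_as)" "j < sum_list (map fst n_as)"
    and "jordan_matrix n_as $$ (i, j) \<noteq> (0 :: complex)" "i \<noteq> j"
  shows "j = Suc i" "jordan_matrix n_as $$ (i, j) = 1"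
    "jordan_matrix n_as $$ (i, i) = jordan_matrix n_as $$ (j, j)"
proof -
  have "j = Suc i \<and> jordan_matrix n_as $$ (i, j) = 1 \<and>
      jordan_matrix n_as $$ (i, i) = jordan_matrix n_as $$ (j, j)"
    using assms
  proof (induction n_as arbitrary: i j)
    case (Cons p n_as)
    obtain n a where p: "p = (n, a)" by force
    show ?case
    proof (cases "i < n \<or> j < n")
      case True
      with Cons.prems show ?thesis
        by (auto simp: p jordan_matrix_Cons split: if_splits)
    next
      case False
      then obtain i' j' where [simp]: "i = n + i'" "j = n + j'" by (auto simp: not_less le_iff_add)
      show ?thesis
        using Cons.prems Cons.IH[of i' j']
        by (auto simp: p jordan_matrix_Cons)
    qed
  qed simp
  then show "j = Suc i" "jordan_matrix n_as $$ (i, j) = 1"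
    "jordan_matrix n_as $$ (i, i) = jordan_matrix n_as $$ (j, j)" by auto
qed

text \<open>In an eigenbasis the hypotheses read \<open>D\<^sub>j v\<^sub>j = c v\<^sub>j\<close> and \<open>D\<^sub>j w\<^sub>j = c w\<^sub>j + v\<^sub>j\<close> for each
  coordinate \<open>j\<close>. If \<open>v\<^sub>j\<close> were nonzero, the first equation would give \<open>D\<^sub>j = c\<close>, and the second
  would then give \<open>v\<^sub>j = 0\<close>.\<close>

lemma diagonalizable_no_generalized_eigenvector:
  assumes M: "M \<in> carrier_mat n n" and "diagonalizable_mat M"
    and v: "v \<in> carrier_vec n" and w: "w \<in> carrier_vec n"
    and Mv: "M *\<^sub>v v = c \<cdot>\<^sub>v v" and Mw: "M *\<^sub>v w = c \<cdot>\<^sub>v w + v"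
  shows "v = 0\<^sub>v n"
proof -
  obtain D P Q where D: "diagonal_mat D" and sim: "similar_mat_wit M D P Q"
    using assms(2) by (auto simp: diagonalizable_mat_def similar_mat_def)
  note s = similar_mat_witD2(1,2,4-7)[OF M sim] and Meq = similar_mat_witD2(3)[OF M sim]
  have conj: "D *\<^sub>v (Q *\<^sub>v x) = Q *\<^sub>v (M *\<^sub>v x)" if x: "x \<in> carrier_vec n" for x
  proof -
    have "Q *\<^sub>v (M *\<^sub>v x) = (Q * M) *\<^sub>v x" using s x M by (simp add: assoc_mult_mat_vec[of _ n n _ n])
    also have "Q * M = (Q * P) * (D * Q)"
      unfolding Meq using s(3-6) by (simp add: assoc_mult_mat[of _ n n _ n _ n])
    also have "\<dots> = D * Q" using s by simp
    also have "\<dots> *\<^sub>v x = D *\<^sub>v (Q *\<^sub>v x)" using s x by (simp add: assoc_mult_mat_vec[of _ n n _ n])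
    finally show ?thesis by simp
  qed
  have diag: "vec_index (D *\<^sub>v y) j = D $$ (j, j) * vec_index y j"
    if "y \<in> carrier_vec n" "j < n" for y j
  proof -
    have "vec_index (D *\<^sub>v y) j = (\<Sum>k = 0..<n. D $$ (j, k) * vec_index y k)"
      using that s(4) by (simp add: scalar_prod_def)
    also have "\<dots> = (\<Sum>k = 0..<n. if k = j then D $$ (j, j) * vec_index y j else 0)"
      using that s(4) D by (intro sum.cong) (auto simp: diagonal_mat_def)
    finally show ?thesis using that by simp
  qed
  have Qv: "Q *\<^sub>v v \<in> carrier_vec n" and Qw: "Q *\<^sub>v w \<in> carrier_vec n" using s v w by auto
  have "D *\<^sub>v (Q *\<^sub>v v) = c \<cdot>\<^sub>v (Q *\<^sub>v v)"
    using conj[OF v] Mv s v by (simp add: mult_mat_vec)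
  then have 1: "D $$ (j, j) * vec_index (Q *\<^sub>v v) j = c * vec_index (Q *\<^sub>v v) j" if "j < n" for j
    using diag[OF Qv that] carrier_vecD[OF Qv] that by auto
  have "D *\<^sub>v (Q *\<^sub>v w) = c \<cdot>\<^sub>v (Q *\<^sub>v w) + Q *\<^sub>v v"
    using conj[OF w] Mw s v w by (simp add: mult_mat_vec mult_add_distrib_mat_vec[of _ n n])
  then have 2: "D $$ (j, j) * vec_index (Q *\<^sub>v w) j
      = c * vec_index (Q *\<^sub>v w) j + vec_index (Q *\<^sub>v v) j" if "j < n" for j
    using diag[OF Qw that] carrier_vecD[OF Qv] that by simp
  have "vec_index (Q *\<^sub>v v) j = 0" if "j < n" for j
    using 1[OF that] 2[OF that] by (cases "vec_index (Q *\<^sub>v v) j = 0") auto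
  then have "Q *\<^sub>v v = 0\<^sub>v n" using carrier_vecD[OF Qv] by (intro eq_vecI) auto
  then have "P *\<^sub>v (Q *\<^sub>v v) = 0\<^sub>v n" using s by (auto intro!: eq_vecI)
  then show ?thesis using assoc_mult_mat_vec[OF s(5,6) v] s(1) v by simp
qed

lemma diagonalizable_mat_similar:
  assumes "similar_mat A B" "diagonalizable_mat B"
  shows "diagonalizable_mat A"
  using assms unfolding diagonalizable_mat_def by (meson similar_mat_trans)

lemma diagonalizable_power:
  assumes "diagonalizable_mat A"
  shows "diagonalizable_mat (A ^\<^sub>m k)"
proof -
  obtain D P Q where D: "diagonal_mat D" and sim: "similar_mat_wit A D P Q"
    using assms by (auto simp: diagonalizable_mat_def similar_mat_def)
  have Dc: "D \<in> carrier_mat (dim_row A) (dim_row A)"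
    by (rule similar_mat_witD(5)[OF refl sim])
  have "D ^\<^sub>m k = mat_diag (dim_row A) (\<lambda>i. D $$ (i, i) ^ k)"
  proof (induction k)
    case (Suc k)
    have D': "mat_diag (dim_row A) (\<lambda>i. D $$ (i, i)) = D"
      using Dc D by (intro eq_matI) (auto simp: mat_diag_def diagonal_mat_def)
    have "D ^\<^sub>m Suc k
        = mat_diag (dim_row A) (\<lambda>i. D $$ (i, i) ^ k) * mat_diag (dim_row A) (\<lambda>i. D $$ (i, i))"
      using Suc unfolding D' by simp
    then show ?case by (simp add: mult.commute)
  qed (use Dc in \<open>auto simp: mat_diag_def intro!: eq_matI\<close>)
  then have "diagonal_mat (D ^\<^sub>m k)" by (auto simp: mat_diag_def diagonal_mat_def)
  moreover have "similar_mat (A ^\<^sub>m k) (D ^\<^sub>m k)"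
    using similar_mat_wit_pow[OF sim] by (auto simp: similar_mat_def)
  ultimately show ?thesis by (auto simp: diagonalizable_mat_def)
qed

text \<open>A Jordan block of size at least 2 with eigenvalue \<open>a \<noteq> 0\<close> contains vectors with \<open>J v = a v\<close> and
  \<open>J w = a w + v\<close>. Then \<open>J\<^sup>N w = a\<^sup>N w + N a\<^sup>N\<^sup>-\<^sup>1 v\<close>, so \<open>N a\<^sup>N\<^sup>-\<^sup>1 v\<close> is an
  eigenvector of \<open>J\<^sup>N\<close> that \<open>diagonalizable_no_generalized_eigenvector\<close> excludes. Invertibility
  matters: a nilpotent block has a diagonalizable power.\<close>

lemma diagonalizable_if_power_diagonalizable:
  assumes A: "A \<in> carrier_mat n n" and B: "B \<in> carrier_mat n n" and BA: "B * A = 1\<^sub>m n"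
    and N: "N > 0" and dN: "diagonalizable_mat (A ^\<^sub>m N)"
  shows "diagonalizable_mat A"
proof -
  obtain n_as where "jordan_nf A n_as"
    using jordan_nf_exists[OF A] char_poly_factorized[OF A] by blast
  then obtain P Q where sim: "similar_mat_wit A (jordan_matrix n_as) P Q"
    by (auto simp: jordan_nf_def similar_mat_def)
  define J where "J = jordan_matrix n_as"
  note s = similar_mat_witD2(1,2,4-7)[OF A sim, folded J_def]
    and Aeq = similar_mat_witD2(3)[OF A sim, folded J_def]
  have J: "J \<in> carrier_mat n n" by (rule s(4))
  have n: "sum_list (map fst n_as) = n"
    using carrier_matD(1)[OF J] jordan_matrix_dim(1)[of n_as] by (simp add: J_def)
  have "similar_mat (J ^\<^sub>m N) (A ^\<^sub>m N)"
    using similar_mat_sym similar_mat_wit_pow[OF sim] unfolding similar_mat_def J_def by blast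
  then have dJ: "diagonalizable_mat (J ^\<^sub>m N)" using dN diagonalizable_mat_similar by blast
  have "diagonal_mat J"
  proof (rule ccontr)
    assume "\<not> diagonal_mat J"
    then have "\<exists>i. Suc i < n \<and> J $$ (i, Suc i) \<noteq> 0"
      using J jordan_matrix_entry(1)[of _ n_as, folded J_def, unfolded n]
      by (auto simp: diagonal_mat_def)
    \<comment> \<open>The first such \<open>i\<close> starts a block, which makes the standard basis vector with index \<open>i\<close> an
      eigenvector.\<close>
    then obtain i where i: "Suc i < n" "J $$ (i, Suc i) \<noteq> 0"
      and least: "\<And>k. k < i \<Longrightarrow> \<not> (Suc k < n \<and> J $$ (k, Suc k) \<noteq> 0)"
      using exists_least_iff[of "\<lambda>i. Suc i < n \<and> J $$ (i, Suc i) \<noteq> 0"] by blast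
    define a where "a = J $$ (i, i)"
    define v w :: "complex Matrix.vec" where "v = unit_vec n i" and "w = unit_vec n (Suc i)"
    have vw: "v \<in> carrier_vec n" "w \<in> carrier_vec n" by (simp_all add: v_def w_def)
    have e: "J $$ (i, Suc i) = 1" "J $$ (Suc i, Suc i) = a"
      using jordan_matrix_entry[of i n_as "Suc i", folded J_def, unfolded n] i by (auto simp: a_def)
    have z: "J $$ (k, l) = 0" if "k < n" "l < n" "l \<noteq> k" "l \<noteq> Suc k" for k l
      using jordan_matrix_entry(1)[of k n_as l, folded J_def, unfolded n] that by auto
    have z': "J $$ (k, i) = 0" if "k < n" "k \<noteq> i" for k
      using z[of k i] least[of k] that i by (cases "i = Suc k") auto
    have Jv: "J *\<^sub>v v = a \<cdot>\<^sub>v v" using J i z'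
      by (intro eq_vecI) (auto simp: v_def a_def)
    have Jw: "J *\<^sub>v w = a \<cdot>\<^sub>v w + v" using J i z e
      by (intro eq_vecI) (auto simp: v_def w_def)
    \<comment> \<open>\<open>P v\<close> is an eigenvector of the invertible matrix \<open>A\<close> with eigenvalue \<open>a\<close>.\<close>
    have "a \<noteq> 0"
    proof
      assume "a = 0"
      then have "J *\<^sub>v v = 0\<^sub>v n" using Jv by (auto simp: v_def)
      then have "P *\<^sub>v (J *\<^sub>v v) = 0\<^sub>v n" using s by (auto intro!: eq_vecI)
      moreover have "P *\<^sub>v (J *\<^sub>v v) = A *\<^sub>v (P *\<^sub>v v)"
      proof -
        have "A * P = P * J * (Q * P)"
          unfolding Aeq using s(3-6) by (simp add: assoc_mult_mat[of _ n n _ n _ n])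
        then have "A * P = P * J" using s by simp
        then show ?thesis
          using assoc_mult_mat_vec[OF A s(5) vw(1)] assoc_mult_mat_vec[OF s(5) J vw(1)] by simp
      qed
      ultimately have "B *\<^sub>v (A *\<^sub>v (P *\<^sub>v v)) = 0\<^sub>v n" using B by (auto intro!: eq_vecI)
      moreover have "P *\<^sub>v v \<in> carrier_vec n" using s vw by simp
      ultimately have "P *\<^sub>v v = 0\<^sub>v n"
        using assoc_mult_mat_vec[OF B A] BA by simp
      then have "Q *\<^sub>v (P *\<^sub>v v) = 0\<^sub>v n" using s by (auto intro!: eq_vecI)
      then have "v = 0\<^sub>v n" using assoc_mult_mat_vec[OF s(6,5) vw(1)] s(2) vw by simp
      then have "vec_index v i = 0" using i by simp
      then show False using i by (simp add: v_def)
    qed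
    have Jk: "J ^\<^sub>m k \<in> carrier_mat n n" for k using J by simp
    have Jkv: "J ^\<^sub>m k *\<^sub>v v = a ^ k \<cdot>\<^sub>v v" for k
    proof (induction k)
      case (Suc k)
      have "J ^\<^sub>m Suc k *\<^sub>v v = J ^\<^sub>m k *\<^sub>v (J *\<^sub>v v)"
        using assoc_mult_mat_vec[OF Jk J] vw by simp
      also have "\<dots> = a ^ Suc k \<cdot>\<^sub>v v"
        unfolding Jv mult_mat_vec[OF Jk vw(1)] Suc smult_smult_assoc by simp
      finally show ?case .
    qed (use vw J in simp)
    have Jkw: "J ^\<^sub>m k *\<^sub>v w = a ^ k \<cdot>\<^sub>v w + (of_nat k * a ^ (k - 1)) \<cdot>\<^sub>v v" for k
    proof (induction k)
      case (Suc k)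
      have "J ^\<^sub>m Suc k *\<^sub>v w = J ^\<^sub>m k *\<^sub>v (J *\<^sub>v w)"
        using assoc_mult_mat_vec[OF Jk J] vw by simp
      also have "\<dots> = a \<cdot>\<^sub>v (J ^\<^sub>m k *\<^sub>v w) + J ^\<^sub>m k *\<^sub>v v" unfolding Jw

          using vw by (simp only: mult_add_distrib_mat_vec[OF Jk _ vw(1)] mult_mat_vec[OF Jk vw(2)] smult_carrier_vec)
      also have "\<dots> = a ^ Suc k \<cdot>\<^sub>v w + (of_nat (Suc k) * a ^ (Suc k - 1)) \<cdot>\<^sub>v v"
        unfolding Suc Jkv using vw
        by (intro eq_vecI) (cases k; simp add: carrier_vecD algebra_simps)+
      finally show ?case .
    qed (use carrier_vecD[OF vw(1)] carrier_vecD[OF vw(2)] vw J in \<open>simp add: Matrix.vec_eq_iff\<close>)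
    let ?u = "(of_nat N * a ^ (N - 1)) \<cdot>\<^sub>v v"
    have "?u = 0\<^sub>v n"
    proof (rule diagonalizable_no_generalized_eigenvector[OF Jk dJ])
      show "J ^\<^sub>m N *\<^sub>v ?u = a ^ N \<cdot>\<^sub>v ?u"
        unfolding mult_mat_vec[OF Jk vw(1)] Jkv smult_smult_assoc by (simp only: mult.commute)
      show "J ^\<^sub>m N *\<^sub>v w = a ^ N \<cdot>\<^sub>v w + ?u" by (rule Jkw)
    qed (use vw in auto)
    then have "vec_index ?u i = 0" using i by (simp only: index_zero_vec)
    then show False using i N \<open>a \<noteq> 0\<close> by (simp add: v_def)
  qed
  then show ?thesis using sim by (auto simp: diagonalizable_mat_def similar_mat_def J_def)
qed

section \<open>Block matrices\<close>

definition block_mat :: "nat \<Rightarrow> nat \<Rightarrow> (nat \<Rightarrow> nat \<Rightarrow> 'a mat) \<Rightarrow> 'a mat" where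
  "block_mat d m B = Matrix.mat (d * m) (d * m) (\<lambda>(r, s). B (r div d) (s div d) $$ (r mod d, s mod d))"

definition block_diag :: "nat \<Rightarrow> nat \<Rightarrow> (nat \<Rightarrow> 'a :: zero mat) \<Rightarrow> 'a mat" where
  "block_diag d m B = block_mat d m (\<lambda>i j. if i = j then B i else 0\<^sub>m d d)"

lemma block_mat_carrier [simp]: "block_mat d m B \<in> carrier_mat (d * m) (d * m)"
  by (simp add: block_mat_def)

lemma block_diag_carrier [simp]: "block_diag d m B \<in> carrier_mat (d * m) (d * m)"
  by (simp add: block_diag_def)

lemma block_index_bounds:
  assumes "r < d * m"
  shows "r div d < m" "r mod d < (d :: nat)"
proof -
  have "d > 0" using assms by (cases d) auto
  then show "r div d < m" "r mod d < d" using assms by (simp_all add: less_mult_imp_div_less mult.commute)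
qed

lemma block_mat_cong:
  assumes "\<And>i j. i < m \<Longrightarrow> j < m \<Longrightarrow> A i j = B i j"
  shows "block_mat d m A = block_mat d m B"
  using block_index_bounds assms by (intro eq_matI) (auto simp: block_mat_def)

lemma block_diag_cong:
  assumes "\<And>i. i < m \<Longrightarrow> A i = B i"
  shows "block_diag d m A = block_diag d m B"
  unfolding block_diag_def using assms by (intro block_mat_cong) auto

lemma sum_over_blocks:
  fixes f :: "nat \<Rightarrow> 'a :: comm_monoid_add"
  shows "(\<Sum>t = 0..<d * m. f t) = (\<Sum>k<m. \<Sum>b<d. f (k * d + b))"
proof (induction m)
  case (Suc m)
  have "(\<Sum>t = 0..<d * Suc m. f t) = (\<Sum>t = 0..<d * m. f t) + (\<Sum>t = d * m..<d * m + d. f t)"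
    by (simp add: sum.atLeastLessThan_concat add.commute)
  also have "(\<Sum>t = d * m..<d * m + d. f t) = (\<Sum>b<d. f (m * d + b))"
    using sum.shift_bounds_nat_ivl[of f 0 "d * m" d] by (simp add: ac_simps atLeast0LessThan)
  finally show ?case using Suc by simp
qed simp

text \<open>The hypothesis that column \<open>j\<close> of blocks of \<open>B\<close> vanishes outside row \<open>f j\<close> leaves a single term
  in the sum over the middle block index. This suffices for monomial patterns, where \<open>f\<close> is a
  permutation, and for block diagonal matrices, where it is the identity.\<close>

lemma block_mat_mult:
  fixes A B :: "nat \<Rightarrow> nat \<Rightarrow> 'a :: semiring_0 mat"
  assumes A: "\<And>i j. i < m \<Longrightarrow> j < m \<Longrightarrow> A i j \<in> carrier_mat d d"
    and B: "\<And>i j. i < m \<Longrightarrow> j < m \<Longrightarrow> B i j \<in> carrier_mat d d"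
    and f: "\<And>j. j < m \<Longrightarrow> f j < m"
    and zero: "\<And>k j. k < m \<Longrightarrow> j < m \<Longrightarrow> k \<noteq> f j \<Longrightarrow> B k j = 0\<^sub>m d d"
  shows "block_mat d m A * block_mat d m B = block_mat d m (\<lambda>i j. A i (f j) * B (f j) j)"
proof (rule eq_matI)
  fix r s
  assume "r < dim_row (block_mat d m (\<lambda>i j. A i (f j) * B (f j) j))"
    "s < dim_col (block_mat d m (\<lambda>i j. A i (f j) * B (f j) j))"
  then have r: "r < d * m" and s: "s < d * m" by (simp_all add: block_mat_def)
  note rb = block_index_bounds[OF r] and sb = block_index_bounds[OF s]
  let ?i = "r div d" and ?a = "r mod d" and ?j = "s div d" and ?b = "s mod d"
  have "(block_mat d m A * block_mat d m B) $$ (r, s)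
      = (\<Sum>t = 0..<d * m. A ?i (t div d) $$ (?a, t mod d) * B (t div d) ?j $$ (t mod d, ?b))"
    using r s by (simp add: block_mat_def scalar_prod_def)
  also have "\<dots> = (\<Sum>k<m. \<Sum>c<d. A ?i k $$ (?a, c) * B k ?j $$ (c, ?b))"
    unfolding sum_over_blocks by (intro sum.cong refl) simp
  also have "\<dots> = (\<Sum>k<m. if k = f ?j then \<Sum>c<d. A ?i k $$ (?a, c) * B k ?j $$ (c, ?b) else 0)"
    using zero rb sb by (intro sum.cong refl) auto
  also have "\<dots> = (\<Sum>c<d. A ?i (f ?j) $$ (?a, c) * B (f ?j) ?j $$ (c, ?b))"
    using f sb by (simp add: sum.delta)
  also have "\<dots> = (A ?i (f ?j) * B (f ?j) ?j) $$ (?a, ?b)"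
    using A[OF rb(1) f[OF sb(1)]] B[OF f[OF sb(1)] sb(1)] rb sb
    by (simp add: scalar_prod_def atLeast0LessThan)
  also have "\<dots> = block_mat d m (\<lambda>i j. A i (f j) * B (f j) j) $$ (r, s)"
    using r s by (simp add: block_mat_def)
  finally show "(block_mat d m A * block_mat d m B) $$ (r, s)
      = block_mat d m (\<lambda>i j. A i (f j) * B (f j) j) $$ (r, s)" .
qed (simp_all add: block_mat_def)

lemma block_diag_mult:
  fixes A B :: "nat \<Rightarrow> 'a :: semiring_0 mat"
  assumes "\<And>i. i < m \<Longrightarrow> A i \<in> carrier_mat d d" "\<And>i. i < m \<Longrightarrow> B i \<in> carrier_mat d d"
  shows "block_diag d m A * block_diag d m B = block_diag d m (\<lambda>i. A i * B i)"
  unfolding block_diag_def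
  by (subst block_mat_mult[where f = "\<lambda>j. j"])
    (use assms in \<open>auto intro!: block_mat_cong left_mult_zero_mat\<close>)

lemma block_diag_one: "block_diag d m (\<lambda>i. 1\<^sub>m d) = 1\<^sub>m (d * m)"
proof (rule eq_matI)
  fix r s assume "r < dim_row (1\<^sub>m (d * m))" "s < dim_col (1\<^sub>m (d * m))"
  then have r: "r < d * m" and s: "s < d * m" by simp_all
  note b = block_index_bounds[OF r] block_index_bounds[OF s]
  have "r = s \<longleftrightarrow> r div d = s div d \<and> r mod d = s mod d"
    by (metis div_mod_decomp)
  then show "block_diag d m (\<lambda>i. 1\<^sub>m d) $$ (r, s) = 1\<^sub>m (d * m) $$ (r, s)"
    using r s b by (auto simp: block_diag_def block_mat_def)
qed (simp_all add: block_diag_def block_mat_def)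

lemma diagonalizable_block_diag:
  assumes B: "\<And>i. i < m \<Longrightarrow> B i \<in> carrier_mat d d"
    and "\<And>i. i < m \<Longrightarrow> diagonalizable_mat (B i)"
  shows "diagonalizable_mat (block_diag d m B)"
proof -
  have "\<forall>i. \<exists>D P Q. i < m \<longrightarrow> diagonal_mat D \<and> similar_mat_wit (B i) D P Q"
    using assms(2) unfolding diagonalizable_mat_def similar_mat_def by blast
  then obtain D P Q where D: "\<And>i. i < m \<Longrightarrow> diagonal_mat (D i)"
    and sim: "\<And>i. i < m \<Longrightarrow> similar_mat_wit (B i) (D i) (P i) (Q i)"
    by metis
  note s = similar_mat_witD2[OF B sim]
  have "similar_mat_wit (block_diag d m B) (block_diag d m D) (block_diag d m P) (block_diag d m Q)"
  proof (rule similar_mat_witI)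
    show "block_diag d m P * block_diag d m Q = 1\<^sub>m (d * m)"
      by (subst block_diag_mult) (use s in \<open>auto intro: block_diag_cong simp flip: block_diag_one\<close>)
    show "block_diag d m Q * block_diag d m P = 1\<^sub>m (d * m)"
      by (subst block_diag_mult) (use s in \<open>auto intro: block_diag_cong simp flip: block_diag_one\<close>)
    have "block_diag d m B = block_diag d m (\<lambda>i. P i * D i * Q i)"
      using s(3) by (intro block_diag_cong) auto
    also have "\<dots> = block_diag d m (\<lambda>i. P i * D i) * block_diag d m Q"
      by (rule block_diag_mult[symmetric]) (use s(5-7) in \<open>auto intro: mult_carrier_mat\<close>)
    also have "block_diag d m (\<lambda>i. P i * D i) = block_diag d m P * block_diag d m D"
      by (rule block_diag_mult[symmetric]) (use s(5-7) in auto)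
    finally show "block_diag d m B = block_diag d m P * block_diag d m D * block_diag d m Q" .
  qed simp_all
  moreover have "diagonal_mat (block_diag d m D)"
    unfolding diagonal_mat_def
  proof (intro allI impI)
    fix r s assume "r < dim_row (block_diag d m D)" "s < dim_col (block_diag d m D)" "r \<noteq> s"
    then have r: "r < d * m" and s': "s < d * m" and "r \<noteq> s"
      by (simp_all add: block_diag_def block_mat_def)
    note b = block_index_bounds[OF r] block_index_bounds[OF s']
    have "\<not> (r div d = s div d \<and> r mod d = s mod d)" using \<open>r \<noteq> s\<close> by (metis div_mod_decomp)
    moreover have "D (r div d) \<in> carrier_mat d d" using s(5) b(1) by blast
    ultimately show "block_diag d m D $$ (r, s) = 0"
      using r s' b D[OF b(1)] by (auto simp: block_diag_def block_mat_def diagonal_mat_def)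
  qed
  ultimately show ?thesis unfolding diagonalizable_mat_def similar_mat_def by blast
qed

section \<open>Matrix representations of subgroups\<close>

lemma carrier_GLC:
  "M \<in> carrier (GLC n) \<longleftrightarrow>
     M \<in> carrier_mat n n \<and> (\<exists>N\<in>carrier_mat n n. N * M = 1\<^sub>m n \<and> M * N = 1\<^sub>m n)"
  by (auto simp: GLC_def units_of_def Units_def ring_mat_def)

lemma mult_GLC [simp]: "A \<otimes>\<^bsub>GLC n\<^esub> B = A * B"
  by (simp add: GLC_def units_of_def ring_mat_def)

interpretation PSL2R: Group.group PSL2R
  by (rule group_PSL2R)

lemma (in Group.group) cancel_inv:
  assumes "x \<in> carrier G" "y \<in> carrier G"
  shows "x \<otimes> (inv x \<otimes> y) = y" "inv x \<otimes> (x \<otimes> y) = y"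
  using assms by (simp_all flip: m_assoc)

text \<open>The values are invertible because multiplicativity makes \<open>\<rho> (inv x)\<close> an inverse of
  \<open>\<rho> x\<close>.\<close>

lemma representationI:
  assumes G: "subgroup G PSL2R"
    and c: "\<And>x. x \<in> G \<Longrightarrow> \<rho> x \<in> carrier_mat n n"
    and m: "\<And>x y. x \<in> G \<Longrightarrow> y \<in> G \<Longrightarrow> \<rho> (x \<otimes>\<^bsub>PSL2R\<^esub> y) = \<rho> x * \<rho> y"
    and one: "\<rho> \<one>\<^bsub>PSL2R\<^esub> = 1\<^sub>m n"
  shows "representation G n \<rho>"
proof -
  have "\<rho> x \<in> carrier (GLC n)" if x: "x \<in> G" for x
  proof -
    have i: "inv\<^bsub>PSL2R\<^esub> x \<in> G" and p: "x \<in> carrier PSL2R"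
      using subgroup.m_inv_closed[OF G x] subgroup.mem_carrier[OF G x] by auto
    show ?thesis unfolding carrier_GLC
      using c[OF x] c[OF i] m[OF x i] m[OF i x] one p by auto
  qed
  then show ?thesis using m by (auto simp: representation_def hom_def)
qed

context
  fixes G n \<rho>
  assumes G: "subgroup G PSL2R" and rep: "representation G n \<rho>"
begin

lemma representation_carrier: "x \<in> G \<Longrightarrow> \<rho> x \<in> carrier_mat n n"
  using rep by (auto simp: representation_def hom_def carrier_GLC)

lemma representation_mult: "x \<in> G \<Longrightarrow> y \<in> G \<Longrightarrow> \<rho> (x \<otimes>\<^bsub>PSL2R\<^esub> y) = \<rho> x * \<rho> y"
  using rep by (auto simp: representation_def hom_def)

text \<open>The value at the unit is an idempotent with a left inverse.\<close>

lemma representation_one: "\<rho> \<one>\<^bsub>PSL2R\<^esub> = 1\<^sub>m n"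
proof -
  let ?M = "\<rho> \<one>\<^bsub>PSL2R\<^esub>"
  have 1: "\<one>\<^bsub>PSL2R\<^esub> \<in> G" using G by (rule subgroup.one_closed)
  have "?M \<in> carrier (GLC n)" using rep 1 by (auto simp: representation_def hom_def)
  then obtain N where N: "N \<in> carrier_mat n n" "N * ?M = 1\<^sub>m n" and M: "?M \<in> carrier_mat n n"
    by (auto simp: carrier_GLC)
  have "?M * ?M = ?M" using representation_mult[OF 1 1] by simp
  then have "N * ?M * ?M = N * ?M" using assoc_mult_mat[OF N(1) M M] by simp
  then show ?thesis using N M by simp
qed

lemma representation_inv:
  assumes "x \<in> G"
  shows "\<rho> (inv\<^bsub>PSL2R\<^esub> x) * \<rho> x = 1\<^sub>m n" "\<rho> x * \<rho> (inv\<^bsub>PSL2R\<^esub> x) = 1\<^sub>m n"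
proof -
  have i: "inv\<^bsub>PSL2R\<^esub> x \<in> G" and p: "x \<in> carrier PSL2R"
    using subgroup.m_inv_closed[OF G assms] subgroup.mem_carrier[OF G assms] by auto
  show "\<rho> (inv\<^bsub>PSL2R\<^esub> x) * \<rho> x = 1\<^sub>m n" "\<rho> x * \<rho> (inv\<^bsub>PSL2R\<^esub> x) = 1\<^sub>m n"
    using representation_mult[OF assms i] representation_mult[OF i assms] p
    by (simp_all add: representation_one)
qed

lemma representation_pow:
  assumes "x \<in> G"
  shows "x [^]\<^bsub>PSL2R\<^esub> (k::nat) \<in> G" "\<rho> (x [^]\<^bsub>PSL2R\<^esub> k) = \<rho> x ^\<^sub>m k"
proof -
  have "x [^]\<^bsub>PSL2R\<^esub> k \<in> G \<and> \<rho> (x [^]\<^bsub>PSL2R\<^esub> k) = \<rho> x ^\<^sub>m k"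
    using assms representation_carrier[OF assms]
    by (induction k) (auto simp: representation_one representation_mult
        subgroup.one_closed[OF G] subgroup.m_closed[OF G])
  then show "x [^]\<^bsub>PSL2R\<^esub> k \<in> G" "\<rho> (x [^]\<^bsub>PSL2R\<^esub> k) = \<rho> x ^\<^sub>m k" by auto
qed

lemma representation_conjugate_similar:
  assumes "x \<in> G" "y \<in> G"
  shows "similar_mat (\<rho> (y \<otimes>\<^bsub>PSL2R\<^esub> x \<otimes>\<^bsub>PSL2R\<^esub> inv\<^bsub>PSL2R\<^esub> y)) (\<rho> x)"
proof (rule similar_matI)
  have i: "inv\<^bsub>PSL2R\<^esub> y \<in> G" using subgroup.m_inv_closed[OF G assms(2)] .
  have yx: "y \<otimes>\<^bsub>PSL2R\<^esub> x \<in> G" using assms subgroup.m_closed[OF G] by blast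
  show "{\<rho> (y \<otimes>\<^bsub>PSL2R\<^esub> x \<otimes>\<^bsub>PSL2R\<^esub> inv\<^bsub>PSL2R\<^esub> y), \<rho> x, \<rho> y, \<rho> (inv\<^bsub>PSL2R\<^esub> y)} \<subseteq> carrier_mat n n"
    using assms i yx subgroup.m_closed[OF G] by (auto intro!: representation_carrier)
  show "\<rho> (y \<otimes>\<^bsub>PSL2R\<^esub> x \<otimes>\<^bsub>PSL2R\<^esub> inv\<^bsub>PSL2R\<^esub> y) = \<rho> y * \<rho> x * \<rho> (inv\<^bsub>PSL2R\<^esub> y)"
    using assms i yx by (simp add: representation_mult)
qed (use representation_inv[OF assms(2)] in auto)

end

lemma equivalent_representation:
  assumes G: "subgroup G PSL2R" and rep: "representation G n \<rho>"
    and PQ: "P \<in> carrier_mat n n" "Q \<in> carrier_mat n n" "P * Q = 1\<^sub>m n" "Q * P = 1\<^sub>m n"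
  defines "\<sigma> \<equiv> \<lambda>x. Q * \<rho> x * P"
  shows "representation G n \<sigma>" "x \<in> G \<Longrightarrow> similar_mat_wit (\<rho> x) (\<sigma> x) P Q"
proof -
  note c = representation_carrier[OF G rep]
  show sim: "similar_mat_wit (\<rho> x) (\<sigma> x) P Q" if "x \<in> G" for x
    unfolding \<sigma>_def
    by (rule similar_mat_wit_sym, rule similar_mat_witI[of _ _ n]) (use PQ c[OF that] in auto)
  show "representation G n \<sigma>"
  proof (rule representationI[OF G])
    fix x y assume x: "x \<in> G" and y: "y \<in> G"
    note cc = c[OF x] c[OF y] PQ(1,2)
    have "\<sigma> x * \<sigma> y = Q * \<rho> x * (P * Q) * \<rho> y * P"
      unfolding \<sigma>_def using cc by (simp add: assoc_mult_mat[of _ n n _ n _ n] del: PQ)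
    then show "\<sigma> (x \<otimes>\<^bsub>PSL2R\<^esub> y) = \<sigma> x * \<sigma> y"
      using cc PQ by (simp add: \<sigma>_def representation_mult[OF G rep x y] assoc_mult_mat[of _ n n _ n _ n])
  qed (use c PQ representation_one[OF G rep] in \<open>auto simp: \<sigma>_def\<close>)
qed

section \<open>The induced representation\<close>

locale induced =
  fixes G H m d \<gamma> \<rho>
  assumes G: "subgroup G PSL2R" and H: "subgroup H PSL2R" and HG: "H \<subseteq> G"
    and transversal: "left_transversal G H m \<gamma>" and rep: "representation H d \<rho>"
begin

definition zero_ext :: "(real^2^2) set \<Rightarrow> complex mat" where
  "zero_ext y = (if y \<in> H then \<rho> y else 0\<^sub>m d d)"

lemma induced_block_mat:
  "induced_representation H d m \<gamma> \<rho> x =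
     block_mat d m (\<lambda>i j. zero_ext (inv\<^bsub>PSL2R\<^esub> (\<gamma> i) \<otimes>\<^bsub>PSL2R\<^esub> x \<otimes>\<^bsub>PSL2R\<^esub> \<gamma> j))"
  by (simp add: induced_representation_def block_mat_def zero_ext_def Let_def)

lemma G_carrier: "x \<in> G \<Longrightarrow> x \<in> carrier PSL2R"
  using subgroup.mem_carrier[OF G] .

lemma gamma_G: "i < m \<Longrightarrow> \<gamma> i \<in> G"
  using transversal by (auto simp: left_transversal_def)

lemma coset_iff:
  assumes "i < m" "x \<in> G"
  shows "x \<in> \<gamma> i <#\<^bsub>PSL2R\<^esub> H \<longleftrightarrow> inv\<^bsub>PSL2R\<^esub> (\<gamma> i) \<otimes>\<^bsub>PSL2R\<^esub> x \<in> H"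
proof
  have g: "\<gamma> i \<in> carrier PSL2R" and x: "x \<in> carrier PSL2R" using assms gamma_G G_carrier by auto
  show "inv\<^bsub>PSL2R\<^esub> (\<gamma> i) \<otimes>\<^bsub>PSL2R\<^esub> x \<in> H" if "x \<in> \<gamma> i <#\<^bsub>PSL2R\<^esub> H"
  proof -
    from that obtain h where h: "h \<in> H" "x = \<gamma> i \<otimes>\<^bsub>PSL2R\<^esub> h" by (auto simp: l_coset_def)
    then have "h \<in> carrier PSL2R" using subgroup.mem_carrier[OF H] by auto
    then show ?thesis using h g by (simp flip: PSL2R.m_assoc)
  qed
  assume *: "inv\<^bsub>PSL2R\<^esub> (\<gamma> i) \<otimes>\<^bsub>PSL2R\<^esub> x \<in> H"
  have "x = \<gamma> i \<otimes>\<^bsub>PSL2R\<^esub> (inv\<^bsub>PSL2R\<^esub> (\<gamma> i) \<otimes>\<^bsub>PSL2R\<^esub> x)" using g x by (simp flip: PSL2R.m_assoc)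
  with * show "x \<in> \<gamma> i <#\<^bsub>PSL2R\<^esub> H" by (auto simp: l_coset_def)
qed

lemma coset_representative_ex1:
  assumes "x \<in> G"
  shows "\<exists>!k. k < m \<and> inv\<^bsub>PSL2R\<^esub> (\<gamma> k) \<otimes>\<^bsub>PSL2R\<^esub> x \<in> H"
proof -
  have "x \<in> (\<Union>i<m. \<gamma> i <#\<^bsub>PSL2R\<^esub> H)" using assms transversal by (auto simp: left_transversal_def)
  then obtain k where k: "k < m" "x \<in> \<gamma> k <#\<^bsub>PSL2R\<^esub> H" by auto
  moreover have "l = k" if "l < m" "x \<in> \<gamma> l <#\<^bsub>PSL2R\<^esub> H" for l
  proof -
    have "disjoint_family_on (\<lambda>i. \<gamma> i <#\<^bsub>PSL2R\<^esub> H) {..<m}"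
      using transversal by (simp add: left_transversal_def)
    then show ?thesis using k that unfolding disjoint_family_on_def by blast
  qed
  ultimately show ?thesis using coset_iff assms by blast
qed

lemma zero_ext_carrier: "zero_ext y \<in> carrier_mat d d"
  using representation_carrier[OF H rep] by (auto simp: zero_ext_def)

lemma zero_ext_mult:
  assumes "y \<in> carrier PSL2R" "z \<in> H"
  shows "zero_ext (y \<otimes>\<^bsub>PSL2R\<^esub> z) = zero_ext y * \<rho> z"
proof -
  have z: "z \<in> carrier PSL2R" "inv\<^bsub>PSL2R\<^esub> z \<in> H"
    using assms subgroup.mem_carrier[OF H] subgroup.m_inv_closed[OF H] by auto
  have "y = (y \<otimes>\<^bsub>PSL2R\<^esub> z) \<otimes>\<^bsub>PSL2R\<^esub> inv\<^bsub>PSL2R\<^esub> z" using assms z by (simp add: PSL2R.m_assoc)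
  then have "y \<otimes>\<^bsub>PSL2R\<^esub> z \<in> H \<longleftrightarrow> y \<in> H"
    using assms(2) z(2) subgroup.m_closed[OF H] by metis
  moreover have "\<rho> z \<in> carrier_mat d d" using representation_carrier[OF H rep assms(2)] .
  ultimately show ?thesis using assms representation_mult[OF H rep] by (auto simp: zero_ext_def)
qed

text \<open>For \<open>y\<close> in \<open>G\<close> and each \<open>j\<close>, exactly one \<open>\<gamma>\<^sub>k\<^sup>-\<^sup>1 y \<gamma>\<^sub>j\<close> lies in \<open>H\<close>, so the
  matrix of \<open>y\<close> has one nonzero block in each column of blocks and \<open>block_mat_mult\<close> applies.\<close>

lemma induced_mult:
  assumes x: "x \<in> G" and y: "y \<in> G"
  shows "induced_representation H d m \<gamma> \<rho> (x \<otimes>\<^bsub>PSL2R\<^esub> y)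
    = induced_representation H d m \<gamma> \<rho> x * induced_representation H d m \<gamma> \<rho> y"
proof -
  have xy: "x \<in> carrier PSL2R" "y \<in> carrier PSL2R" using x y G_carrier by auto
  have g: "\<gamma> j \<in> carrier PSL2R" if "j < m" for j using that gamma_G G_carrier by auto
  \<comment> \<open>Left multiplication by \<open>y\<close> permutes the cosets; \<open>f\<close> is this permutation on indices.\<close>
  have "\<forall>j. \<exists>k. j < m \<longrightarrow> k < m \<and> inv\<^bsub>PSL2R\<^esub> (\<gamma> k) \<otimes>\<^bsub>PSL2R\<^esub> (y \<otimes>\<^bsub>PSL2R\<^esub> \<gamma> j) \<in> H"
    using coset_representative_ex1 subgroup.m_closed[OF G y] gamma_G by blast
  then obtain f where f: "\<And>j. j < m \<Longrightarrow> f j < m"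
    "\<And>j. j < m \<Longrightarrow> inv\<^bsub>PSL2R\<^esub> (\<gamma> (f j)) \<otimes>\<^bsub>PSL2R\<^esub> (y \<otimes>\<^bsub>PSL2R\<^esub> \<gamma> j) \<in> H"
    by metis
  have fH: "inv\<^bsub>PSL2R\<^esub> (\<gamma> (f j)) \<otimes>\<^bsub>PSL2R\<^esub> y \<otimes>\<^bsub>PSL2R\<^esub> \<gamma> j \<in> H" if "j < m" for j
    using f[OF that] g[OF that] g[of "f j"] xy by (simp add: PSL2R.m_assoc)
  have unique: "k = f j" if "k < m" "j < m" "inv\<^bsub>PSL2R\<^esub> (\<gamma> k) \<otimes>\<^bsub>PSL2R\<^esub> y \<otimes>\<^bsub>PSL2R\<^esub> \<gamma> j \<in> H" for k j
  proof -
    have "inv\<^bsub>PSL2R\<^esub> (\<gamma> k) \<otimes>\<^bsub>PSL2R\<^esub> (y \<otimes>\<^bsub>PSL2R\<^esub> \<gamma> j) \<in> H"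
      using that g xy by (simp add: PSL2R.m_assoc)
    then show ?thesis
      using coset_representative_ex1[OF subgroup.m_closed[OF G y gamma_G[OF that(2)]]]
        f[OF that(2)] that(1) by blast
  qed
  have "induced_representation H d m \<gamma> \<rho> x * induced_representation H d m \<gamma> \<rho> y
      = block_mat d m (\<lambda>i j. zero_ext (inv\<^bsub>PSL2R\<^esub> (\<gamma> i) \<otimes>\<^bsub>PSL2R\<^esub> x \<otimes>\<^bsub>PSL2R\<^esub> \<gamma> (f j))
          * zero_ext (inv\<^bsub>PSL2R\<^esub> (\<gamma> (f j)) \<otimes>\<^bsub>PSL2R\<^esub> y \<otimes>\<^bsub>PSL2R\<^esub> \<gamma> j))"
    unfolding induced_block_mat
    by (rule block_mat_mult) (use f unique zero_ext_carrier in \<open>auto simp: zero_ext_def\<close>)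
  also have "\<dots> = induced_representation H d m \<gamma> \<rho> (x \<otimes>\<^bsub>PSL2R\<^esub> y)"
    unfolding induced_block_mat
  proof (rule block_mat_cong)
    fix i j assume ij: "i < m" "j < m"
    note c = g[OF ij(1)] g[OF ij(2)] g[OF f(1)[OF ij(2)]] xy
    have "inv\<^bsub>PSL2R\<^esub> (\<gamma> i) \<otimes>\<^bsub>PSL2R\<^esub> (x \<otimes>\<^bsub>PSL2R\<^esub> y) \<otimes>\<^bsub>PSL2R\<^esub> \<gamma> j =
        inv\<^bsub>PSL2R\<^esub> (\<gamma> i) \<otimes>\<^bsub>PSL2R\<^esub> x \<otimes>\<^bsub>PSL2R\<^esub> \<gamma> (f j) \<otimes>\<^bsub>PSL2R\<^esub>
        (inv\<^bsub>PSL2R\<^esub> (\<gamma> (f j)) \<otimes>\<^bsub>PSL2R\<^esub> y \<otimes>\<^bsub>PSL2R\<^esub> \<gamma> j)"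
      using c by (simp add: PSL2R.m_assoc PSL2R.cancel_inv)
    then have "zero_ext (inv\<^bsub>PSL2R\<^esub> (\<gamma> i) \<otimes>\<^bsub>PSL2R\<^esub> (x \<otimes>\<^bsub>PSL2R\<^esub> y) \<otimes>\<^bsub>PSL2R\<^esub> \<gamma> j)
        = zero_ext (inv\<^bsub>PSL2R\<^esub> (\<gamma> i) \<otimes>\<^bsub>PSL2R\<^esub> x \<otimes>\<^bsub>PSL2R\<^esub> \<gamma> (f j))
          * \<rho> (inv\<^bsub>PSL2R\<^esub> (\<gamma> (f j)) \<otimes>\<^bsub>PSL2R\<^esub> y \<otimes>\<^bsub>PSL2R\<^esub> \<gamma> j)"
      using zero_ext_mult[OF _ fH[OF ij(2)]] c by simp
    then show "zero_ext (inv\<^bsub>PSL2R\<^esub> (\<gamma> i) \<otimes>\<^bsub>PSL2R\<^esub> x \<otimes>\<^bsub>PSL2R\<^esub> \<gamma> (f j))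
          * zero_ext (inv\<^bsub>PSL2R\<^esub> (\<gamma> (f j)) \<otimes>\<^bsub>PSL2R\<^esub> y \<otimes>\<^bsub>PSL2R\<^esub> \<gamma> j)
        = zero_ext (inv\<^bsub>PSL2R\<^esub> (\<gamma> i) \<otimes>\<^bsub>PSL2R\<^esub> (x \<otimes>\<^bsub>PSL2R\<^esub> y) \<otimes>\<^bsub>PSL2R\<^esub> \<gamma> j)"
      using fH[OF ij(2)] by (simp add: zero_ext_def)
  qed
  finally show ?thesis by simp
qed

lemma induced_block_diag:
  assumes x: "x \<in> G" and "\<And>i. i < m \<Longrightarrow> inv\<^bsub>PSL2R\<^esub> (\<gamma> i) \<otimes>\<^bsub>PSL2R\<^esub> x \<otimes>\<^bsub>PSL2R\<^esub> \<gamma> i \<in> H"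
  shows "induced_representation H d m \<gamma> \<rho> x
    = block_diag d m (\<lambda>i. \<rho> (inv\<^bsub>PSL2R\<^esub> (\<gamma> i) \<otimes>\<^bsub>PSL2R\<^esub> x \<otimes>\<^bsub>PSL2R\<^esub> \<gamma> i))"
proof -
  have g: "\<gamma> j \<in> carrier PSL2R" if "j < m" for j using that gamma_G G_carrier by auto
  have "i = j" if ij: "i < m" "j < m" "inv\<^bsub>PSL2R\<^esub> (\<gamma> i) \<otimes>\<^bsub>PSL2R\<^esub> x \<otimes>\<^bsub>PSL2R\<^esub> \<gamma> j \<in> H" for i j
  proof -
    have "inv\<^bsub>PSL2R\<^esub> (\<gamma> i) \<otimes>\<^bsub>PSL2R\<^esub> (x \<otimes>\<^bsub>PSL2R\<^esub> \<gamma> j) \<in> H"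
      "inv\<^bsub>PSL2R\<^esub> (\<gamma> j) \<otimes>\<^bsub>PSL2R\<^esub> (x \<otimes>\<^bsub>PSL2R\<^esub> \<gamma> j) \<in> H"
      using ij assms(2)[OF ij(2)] g G_carrier[OF x] by (simp_all add: PSL2R.m_assoc)
    then show ?thesis
      using coset_representative_ex1[OF subgroup.m_closed[OF G x gamma_G[OF ij(2)]]] ij by blast
  qed
  then show ?thesis unfolding induced_block_mat block_diag_def
    using assms(2) by (intro block_mat_cong) (auto simp: zero_ext_def)
qed

lemma representation_induced: "representation G (d * m) (induced_representation H d m \<gamma> \<rho>)"
proof (rule representationI[OF G _ induced_mult])
  have "induced_representation H d m \<gamma> \<rho> \<one>\<^bsub>PSL2R\<^esub>
    = block_diag d m (\<lambda>i. \<rho> (inv\<^bsub>PSL2R\<^esub> (\<gamma> i) \<otimes>\<^bsub>PSL2R\<^esub> \<one>\<^bsub>PSL2R\<^esub> \<otimes>\<^bsub>PSL2R\<^esub> \<gamma> i))"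
    using G_carrier gamma_G subgroup.one_closed[OF H] subgroup.one_closed[OF G]
    by (intro induced_block_diag) auto
  also have "\<dots> = block_diag d m (\<lambda>i. 1\<^sub>m d)"
    using G_carrier gamma_G representation_one[OF H rep] by (intro block_diag_cong) auto
  finally show "induced_representation H d m \<gamma> \<rho> \<one>\<^bsub>PSL2R\<^esub> = 1\<^sub>m (d * m)" by (simp add: block_diag_one)
qed (simp_all add: induced_block_mat)

text \<open>There are only finitely many cosets, so \<open>t\<^sup>p g H = t\<^sup>q g H\<close> for some \<open>p < q\<close>, and
  \<open>n = q - p\<close> works.\<close>

lemma power_conjugate_in_subgroup:
  assumes t: "t \<in> G" and g: "g \<in> G"
  shows "\<exists>n>0. inv\<^bsub>PSL2R\<^esub> g \<otimes>\<^bsub>PSL2R\<^esub> t [^]\<^bsub>PSL2R\<^esub> (n::nat) \<otimes>\<^bsub>PSL2R\<^esub> g \<in> H"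
proof -
  have tc: "t \<in> carrier PSL2R" and gc: "g \<in> carrier PSL2R" using t g G_carrier by auto
  have pow: "t [^]\<^bsub>PSL2R\<^esub> (n::nat) \<in> G" for n
    by (induction n) (use t subgroup.one_closed[OF G] subgroup.m_closed[OF G] in auto)
  have "\<forall>n. \<exists>k<m. inv\<^bsub>PSL2R\<^esub> (\<gamma> k) \<otimes>\<^bsub>PSL2R\<^esub> (t [^]\<^bsub>PSL2R\<^esub> (n::nat) \<otimes>\<^bsub>PSL2R\<^esub> g) \<in> H"
    using coset_representative_ex1 subgroup.m_closed[OF G pow g] by blast
  then obtain c where c: "\<And>n. c n < m"
    "\<And>n. inv\<^bsub>PSL2R\<^esub> (\<gamma> (c n)) \<otimes>\<^bsub>PSL2R\<^esub> (t [^]\<^bsub>PSL2R\<^esub> (n::nat) \<otimes>\<^bsub>PSL2R\<^esub> g) \<in> H"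
    by metis
  have "finite (range c)" using c(1) by (auto intro: finite_subset[of _ "{..<m}"])
  then have "\<not> inj c" using finite_imageD infinite_UNIV_nat by blast
  then obtain a b where "a \<noteq> b" "c a = c b" by (auto simp: inj_def)
  then obtain p q where pq: "p < q" "c p = c q" by (metis linorder_neqE_nat)
  let ?x = "t [^]\<^bsub>PSL2R\<^esub> p \<otimes>\<^bsub>PSL2R\<^esub> g" and ?y = "t [^]\<^bsub>PSL2R\<^esub> q \<otimes>\<^bsub>PSL2R\<^esub> g" and ?k = "\<gamma> (c p)"
  have k: "?k \<in> carrier PSL2R" using c gamma_G G_carrier by auto
  have "inv\<^bsub>PSL2R\<^esub> (inv\<^bsub>PSL2R\<^esub> ?k \<otimes>\<^bsub>PSL2R\<^esub> ?x) \<otimes>\<^bsub>PSL2R\<^esub> (inv\<^bsub>PSL2R\<^esub> ?k \<otimes>\<^bsub>PSL2R\<^esub> ?y) \<in> H"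
    using c(2)[of p] c(2)[of q] pq subgroup.m_closed[OF H] subgroup.m_inv_closed[OF H] by auto
  also have "inv\<^bsub>PSL2R\<^esub> (inv\<^bsub>PSL2R\<^esub> ?k \<otimes>\<^bsub>PSL2R\<^esub> ?x) \<otimes>\<^bsub>PSL2R\<^esub> (inv\<^bsub>PSL2R\<^esub> ?k \<otimes>\<^bsub>PSL2R\<^esub> ?y)
      = inv\<^bsub>PSL2R\<^esub> g \<otimes>\<^bsub>PSL2R\<^esub> (inv\<^bsub>PSL2R\<^esub> (t [^]\<^bsub>PSL2R\<^esub> p) \<otimes>\<^bsub>PSL2R\<^esub> t [^]\<^bsub>PSL2R\<^esub> q) \<otimes>\<^bsub>PSL2R\<^esub> g"
    using k gc tc by (simp add: PSL2R.inv_mult_group PSL2R.m_assoc PSL2R.cancel_inv)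
  also have "t [^]\<^bsub>PSL2R\<^esub> q = t [^]\<^bsub>PSL2R\<^esub> p \<otimes>\<^bsub>PSL2R\<^esub> t [^]\<^bsub>PSL2R\<^esub> (q - p)"
    using pq tc by (simp add: PSL2R.nat_pow_mult)
  also have "inv\<^bsub>PSL2R\<^esub> (t [^]\<^bsub>PSL2R\<^esub> p) \<otimes>\<^bsub>PSL2R\<^esub> (t [^]\<^bsub>PSL2R\<^esub> p \<otimes>\<^bsub>PSL2R\<^esub> t [^]\<^bsub>PSL2R\<^esub> (q - p)) = t [^]\<^bsub>PSL2R\<^esub> (q - p)"
    using tc by (simp add: PSL2R.cancel_inv)
  finally show ?thesis using pq by (intro exI[of _ "q - p"]) auto
qed

lemma common_power_conjugate_in_subgroup:
  assumes t: "t \<in> G"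
  shows "\<exists>n>0. \<forall>i<m. inv\<^bsub>PSL2R\<^esub> (\<gamma> i) \<otimes>\<^bsub>PSL2R\<^esub> t [^]\<^bsub>PSL2R\<^esub> (n::nat) \<otimes>\<^bsub>PSL2R\<^esub> \<gamma> i \<in> H"
proof -
  have "\<forall>i\<in>{..<m}. \<exists>n>0. inv\<^bsub>PSL2R\<^esub> (\<gamma> i) \<otimes>\<^bsub>PSL2R\<^esub> t [^]\<^bsub>PSL2R\<^esub> (n::nat) \<otimes>\<^bsub>PSL2R\<^esub> \<gamma> i \<in> H"
    using power_conjugate_in_subgroup[OF t gamma_G] by blast
  then obtain n :: "nat \<Rightarrow> nat" where n: "\<And>i. i < m \<Longrightarrow> n i > 0"
    "\<And>i. i < m \<Longrightarrow> inv\<^bsub>PSL2R\<^esub> (\<gamma> i) \<otimes>\<^bsub>PSL2R\<^esub> t [^]\<^bsub>PSL2R\<^esub> n i \<otimes>\<^bsub>PSL2R\<^esub> \<gamma> i \<in> H"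
    by (metis lessThan_iff)
  have tc: "t \<in> carrier PSL2R" using t G_carrier by auto
  have "inv\<^bsub>PSL2R\<^esub> (\<gamma> i) \<otimes>\<^bsub>PSL2R\<^esub> t [^]\<^bsub>PSL2R\<^esub> (\<Prod>i<m. n i) \<otimes>\<^bsub>PSL2R\<^esub> \<gamma> i \<in> H" if i: "i < m" for i
  proof -
    have g: "\<gamma> i \<in> carrier PSL2R" using i gamma_G G_carrier by auto
    define s where "s = t [^]\<^bsub>PSL2R\<^esub> n i"
    have s: "s \<in> carrier PSL2R" using tc by (simp add: s_def)
    have "inv\<^bsub>PSL2R\<^esub> (\<gamma> i) \<otimes>\<^bsub>PSL2R\<^esub> s [^]\<^bsub>PSL2R\<^esub> (k::nat) \<otimes>\<^bsub>PSL2R\<^esub> \<gamma> i \<in> H" for k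
    proof (induction k)
      case (Suc k)
      have sk: "s [^]\<^bsub>PSL2R\<^esub> k \<in> carrier PSL2R" using s by simp
      have "(inv\<^bsub>PSL2R\<^esub> (\<gamma> i) \<otimes>\<^bsub>PSL2R\<^esub> s [^]\<^bsub>PSL2R\<^esub> k \<otimes>\<^bsub>PSL2R\<^esub> \<gamma> i)
          \<otimes>\<^bsub>PSL2R\<^esub> (inv\<^bsub>PSL2R\<^esub> (\<gamma> i) \<otimes>\<^bsub>PSL2R\<^esub> s \<otimes>\<^bsub>PSL2R\<^esub> \<gamma> i) \<in> H"
        using subgroup.m_closed[OF H Suc n(2)[OF i]] by (simp add: s_def)
      also have "(inv\<^bsub>PSL2R\<^esub> (\<gamma> i) \<otimes>\<^bsub>PSL2R\<^esub> s [^]\<^bsub>PSL2R\<^esub> k \<otimes>\<^bsub>PSL2R\<^esub> \<gamma> i)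
          \<otimes>\<^bsub>PSL2R\<^esub> (inv\<^bsub>PSL2R\<^esub> (\<gamma> i) \<otimes>\<^bsub>PSL2R\<^esub> s \<otimes>\<^bsub>PSL2R\<^esub> \<gamma> i)
        = inv\<^bsub>PSL2R\<^esub> (\<gamma> i) \<otimes>\<^bsub>PSL2R\<^esub> s [^]\<^bsub>PSL2R\<^esub> Suc k \<otimes>\<^bsub>PSL2R\<^esub> \<gamma> i"
        using g s sk by (simp add: PSL2R.m_assoc PSL2R.cancel_inv)
      finally show ?case .
    qed (use g subgroup.one_closed[OF H] in auto)
    moreover have "(\<Prod>i<m. n i) = n i * (\<Prod>i\<in>{..<m} - {i}. n i)"
      using i by (intro prod.remove) auto
    ultimately show ?thesis using tc by (simp add: s_def PSL2R.nat_pow_pow)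
  qed
  moreover have "(\<Prod>i<m. n i) > 0" using n(1) by (simp add: prod_pos)
  ultimately show ?thesis by blast
qed

end

section \<open>Parabolic elements fixing a boundary point\<close>

lemma mat2_index [simp]:
  "mat2 a b c d $ 1 $ 1 = a" "mat2 a b c d $ 1 $ 2 = b" "mat2 a b c d $ 2 $ 1 = c" "mat2 a b c d $ 2 $ 2 = d"
  by (simp_all add: mat2_def)

lemma mat2_eta: "A = mat2 (A$1$1) (A$1$2) (A$2$1) (A$2$2)"
  by (simp add: Finite_Cartesian_Product.vec_eq_iff forall_2)

lemma mat2_eq_iff: "mat2 a b c d = mat2 a' b' c' d' \<longleftrightarrow> a = a' \<and> b = b' \<and> c = c' \<and> d = d'"
  by (auto simp: Finite_Cartesian_Product.vec_eq_iff forall_2)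

lemma mat2_mult:
  "mat2 a b c d ** mat2 a' b' c' d' = mat2 (a * a' + b * c') (a * b' + b * d') (c * a' + d * c') (c * b' + d * d')"
  by (simp add: Finite_Cartesian_Product.vec_eq_iff forall_2 matrix_matrix_mult_def sum_2)

lemma mat2_uminus: "- mat2 a b c d = mat2 (- a) (- b) (- c) (- d)"
  by (simp add: Finite_Cartesian_Product.vec_eq_iff forall_2)

lemma mat2_one: "Finite_Cartesian_Product.mat 1 = mat2 1 0 0 1"
  by (simp add: Finite_Cartesian_Product.vec_eq_iff forall_2 Finite_Cartesian_Product.mat_def)

lemma mat2_SL2R [simp]: "mat2 a b c d \<in> carrier SL2R \<longleftrightarrow> a * d - b * c = 1"
  by (simp add: SL2R_def det_2)

lemma pm_mat2_carrier [simp]: "a * d - b * c = 1 \<Longrightarrow> pm (mat2 a b c d) \<in> carrier PSL2R"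
  by (simp add: carrier_PSL2R)

lemma PSL2R_cases:
  assumes "g \<in> carrier PSL2R"
  obtains a b c d where "g = pm (mat2 a b c d)" "a * d - b * c = 1"
proof -
  from assms obtain A where A: "A \<in> carrier SL2R" "g = pm A" by (auto simp: carrier_PSL2R)
  then show ?thesis using that[of "A$1$1" "A$1$2" "A$2$1" "A$2$2"] mat2_eta[of A]
    by (metis mat2_SL2R)
qed

lemma pm_mult: "pm A \<otimes>\<^bsub>PSL2R\<^esub> pm B = pm (A ** B)"
proof -
  have n: "- A ** B = - (A ** B)" "A ** - B = - (A ** B)" for A B :: "real^2^2"
    by (simp_all add: matrix_matrix_mult_def Finite_Cartesian_Product.vec_eq_iff sum_negf)
  show ?thesis
    by (auto simp: PSL2R_def FactGroup_def set_mult_def SL2R_def pm_def n)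
qed

lemma pm_one: "\<one>\<^bsub>PSL2R\<^esub> = pm (mat2 1 0 0 1)"
  by (simp add: PSL2R_def FactGroup_def pm_def mat2_one)

lemma pm_eq_iff: "pm A = pm B \<longleftrightarrow> A = B \<or> A = - B"
  by (auto simp: pm_def doubleton_eq_iff)

lemma pm_inv: "a * d - b * c = 1 \<Longrightarrow> inv\<^bsub>PSL2R\<^esub> (pm (mat2 a b c d)) = pm (mat2 d (- b) (- c) a)"
  by (rule PSL2R.inv_equality) (simp_all add: pm_mult pm_one mat2_mult algebra_simps)

lemma some_matrix_pm: "some_matrix (pm A) = A \<or> some_matrix (pm A) = - A"
  using someI[of "\<lambda>B. B \<in> pm A" A] by (auto simp: some_matrix_def pm_def)

lemma act_bd_pm: "act_bd (pm A) = mat_act_bd A"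
proof -
  have "mat_act_bd (- A) c = mat_act_bd A c" for c
  proof (cases c)
    case (Fin x)
    have "- (A$2$1 * x) - A$2$2 = - (A$2$1 * x + A$2$2)" "- (A$1$1 * x) - A$1$2 = - (A$1$1 * x + A$1$2)"
      by simp_all
    then show ?thesis unfolding Fin mat_act_bd.simps vector_uminus_component mult_minus_left
      by (simp only: diff_conv_add_uminus[symmetric] minus_divide_divide neg_equal_0_iff_equal)
  qed simp
  then show ?thesis using some_matrix_pm[of A] by (auto simp: act_bd_def fun_eq_iff)
qed

text \<open>\<open>(bd_fst c, bd_snd c)\<close> are homogeneous coordinates of the boundary point \<open>c\<close>. They let infinity
  and the finite points be treated alike.\<close>

fun bd_fst :: "bdpoint \<Rightarrow> real" where
  "bd_fst Infty = 1"
| "bd_fst (Fin x) = x"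

fun bd_snd :: "bdpoint \<Rightarrow> real" where
  "bd_snd Infty = 0"
| "bd_snd (Fin x) = 1"

lemma mat_act_bd_homogeneous:
  assumes "a * d - b * e = 1"
  shows "\<exists>s. s \<noteq> 0 \<and> a * bd_fst c + b * bd_snd c = s * bd_fst (mat_act_bd (mat2 a b e d) c)
    \<and> e * bd_fst c + d * bd_snd c = s * bd_snd (mat_act_bd (mat2 a b e d) c)"
proof (cases c)
  case Infty
  then show ?thesis using assms by (cases "e = 0") auto
next
  case (Fin x)
  show ?thesis
  proof (cases "e * x + d = 0")
    case True
    have "a * x + b \<noteq> 0"
    proof
      assume *: "a * x + b = 0"
      have "a * d - b * e = a * (e * x + d) - e * (a * x + b)" by (simp add: algebra_simps)
      then show False using assms unfolding True * by simp
    qed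
    then show ?thesis using True Fin by auto
  qed (use Fin in auto)
qed

text \<open>With \<open>(x, y)\<close> the homogeneous coordinates of \<open>c\<close>, this is \<open>I + h N\<close> for the nilpotent matrix
  \<open>N\<close> that kills \<open>(x, y)\<close> and sends \<open>(u, v)\<close> to \<open>(x v - y u)\<close> times \<open>(x, y)\<close>. It unifies
  \<open>transl h\<close>, the case of infinity, and \<open>cusp_transl c h\<close>, the case of a finite point.\<close>

definition cusp_elt :: "bdpoint \<Rightarrow> real \<Rightarrow> (real^2^2) set" where
  "cusp_elt c h = pm (mat2 (1 - h * bd_fst c * bd_snd c) (h * bd_fst c ^ 2)
     (- h * bd_snd c ^ 2) (1 + h * bd_fst c * bd_snd c))"

lemma cusp_elt_det:
  "(1 - h * x * y) * (1 + h * x * y) - h * x ^ 2 * (- h * y ^ 2) = (1 :: real)"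
  by (simp add: algebra_simps power2_eq_square)

lemma cusp_elt_carrier [simp]: "cusp_elt c h \<in> carrier PSL2R"
  unfolding cusp_elt_def by (rule pm_mat2_carrier[OF cusp_elt_det])

lemma transl_eq_cusp_elt: "transl h = cusp_elt Infty h"
  by (simp add: transl_def cusp_elt_def)

lemma cusp_transl_eq_cusp_elt: "cusp_transl c h = cusp_elt (Fin c) h"
  by (simp add: cusp_transl_def transl_def cusp_elt_def pm_inv pm_mult mat2_mult algebra_simps power2_eq_square)

lemma cusp_elt_add: "cusp_elt c h \<otimes>\<^bsub>PSL2R\<^esub> cusp_elt c k = cusp_elt c (h + k)"
  unfolding cusp_elt_def pm_mult mat2_mult
  by (rule arg_cong[of _ _ pm], unfold mat2_eq_iff) (simp add: algebra_simps power2_eq_square)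

lemma cusp_elt_0: "cusp_elt c 0 = \<one>\<^bsub>PSL2R\<^esub>"
  by (simp add: cusp_elt_def pm_one)

lemma cusp_elt_inv: "inv\<^bsub>PSL2R\<^esub> (cusp_elt c h) = cusp_elt c (- h)"
  by (rule PSL2R.inv_equality) (simp_all add: cusp_elt_add cusp_elt_0)

lemma cusp_elt_pow: "cusp_elt c h [^]\<^bsub>PSL2R\<^esub> (n::nat) = cusp_elt c (n * h)"
  by (induction n) (simp_all add: cusp_elt_0 cusp_elt_add algebra_simps)

lemma cusp_elt_int_pow: "cusp_elt c h [^]\<^bsub>PSL2R\<^esub> (k::int) = cusp_elt c (k * h)"
  by (simp add: int_pow_def2 cusp_elt_pow cusp_elt_inv)

lemma cusp_elt_inject: "cusp_elt c h = cusp_elt c k \<longleftrightarrow> h = k"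
  by (cases c) (auto simp: cusp_elt_def pm_eq_iff mat2_uminus mat2_eq_iff)

lemma act_bd_cusp_elt: "act_bd (cusp_elt c h) c = c"
  by (cases c) (simp_all add: cusp_elt_def act_bd_pm algebra_simps power2_eq_square)

lemma parabolic_cusp_elt: "h \<noteq> 0 \<Longrightarrow> parabolic (cusp_elt c h)"
  unfolding parabolic_def
proof (intro conjI cusp_elt_carrier)
  show "cusp_elt c h \<noteq> \<one>\<^bsub>PSL2R\<^esub>" if "h \<noteq> 0"
    using that cusp_elt_inject[of c h 0] by (simp add: cusp_elt_0)
  define M where "M = mat2 (1 - h * bd_fst c * bd_snd c) (h * bd_fst c ^ 2)
     (- h * bd_snd c ^ 2) (1 + h * bd_fst c * bd_snd c)"
  have "Determinants.trace M = 2" by (simp add: M_def Determinants.trace_def sum_2)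
  moreover have "Determinants.trace (- M) = - Determinants.trace M"
    by (simp add: Determinants.trace_def sum_negf)
  ultimately show "\<bar>Determinants.trace (some_matrix (cusp_elt c h))\<bar> = 2"
    using some_matrix_pm[of M] unfolding cusp_elt_def M_def[symmetric] by auto
qed

text \<open>For \<open>v = (x, y)\<close> and \<open>g\<close> of determinant 1, the nilpotent matrix attached to \<open>v\<close> is conjugated
  by \<open>g\<close> to the one attached to \<open>g v\<close>. As \<open>g v\<close> is \<open>s\<close> times the normalized coordinates of the
  image point and the nilpotent matrix is quadratic in the vector, the width is scaled by the
  factor \<open>s\<^sup>2\<close>.\<close>

lemma cusp_elt_conjugate_matrix:
  assumes det: "a * d - b * e = 1"
    and u: "a * bd_fst c + b * bd_snd c = s * bd_fst c'"
    and w: "e * bd_fst c + d * bd_snd c = s * bd_snd c'"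
  shows "pm (mat2 a b e d) \<otimes>\<^bsub>PSL2R\<^esub> cusp_elt c h \<otimes>\<^bsub>PSL2R\<^esub> inv\<^bsub>PSL2R\<^esub> (pm (mat2 a b e d))
    = cusp_elt c' (s ^ 2 * h)"
proof -
  define x y where "x = bd_fst c" and "y = bd_snd c"
  define u w where "u = a * x + b * y" and "w = e * x + d * y"
  have 1: "u * e - w * a = - y" and 2: "u * d - w * b = x"
  proof -
    have "u * e - w * a = - y * (a * d - b * e)" "u * d - w * b = x * (a * d - b * e)"
      by (simp_all add: u_def w_def algebra_simps)
    then show "u * e - w * a = - y" "u * d - w * b = x" using det by simp_all
  qed
  have c': "cusp_elt c' (s ^ 2 * h) = pm (mat2 (1 - h * u * w) (h * u ^ 2) (- h * w ^ 2) (1 + h * u * w))"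
    using assms(2,3) unfolding cusp_elt_def x_def[symmetric] y_def[symmetric] u_def[symmetric] w_def[symmetric]
    by (simp add: power2_eq_square mult_ac)
  have "mat2 a b e d ** mat2 (1 - h * x * y) (h * x ^ 2) (- h * y ^ 2) (1 + h * x * y)
      = mat2 (1 - h * u * w) (h * u ^ 2) (- h * w ^ 2) (1 + h * u * w) ** mat2 a b e d"
    unfolding mat2_mult mat2_eq_iff
  proof (intro conjI)
    have "a * (1 - h * x * y) + b * (- h * y ^ 2) = a - h * y * u"
      by (simp add: u_def algebra_simps power2_eq_square)
    also have "\<dots> = a + h * u * (u * e - w * a)" unfolding 1 by simp
    also have "\<dots> = (1 - h * u * w) * a + h * u ^ 2 * e" by (simp add: algebra_simps power2_eq_square)
    finally show "a * (1 - h * x * y) + b * (- h * y ^ 2) = (1 - h * u * w) * a + h * u ^ 2 * e" .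
    have "a * (h * x ^ 2) + b * (1 + h * x * y) = b + h * u * x"
      by (simp add: u_def algebra_simps power2_eq_square)
    also have "\<dots> = b + h * u * (u * d - w * b)" unfolding 2 by simp
    also have "\<dots> = (1 - h * u * w) * b + h * u ^ 2 * d" by (simp add: algebra_simps power2_eq_square)
    finally show "a * (h * x ^ 2) + b * (1 + h * x * y) = (1 - h * u * w) * b + h * u ^ 2 * d" .
    have "e * (1 - h * x * y) + d * (- h * y ^ 2) = e - h * y * w"
      by (simp add: w_def algebra_simps power2_eq_square)
    also have "\<dots> = e + h * w * (u * e - w * a)" unfolding 1 by simp
    also have "\<dots> = - h * w ^ 2 * a + (1 + h * u * w) * e" by (simp add: algebra_simps power2_eq_square)
    finally show "e * (1 - h * x * y) + d * (- h * y ^ 2) = - h * w ^ 2 * a + (1 + h * u * w) * e" .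
    have "e * (h * x ^ 2) + d * (1 + h * x * y) = d + h * w * x"
      by (simp add: w_def algebra_simps power2_eq_square)
    also have "\<dots> = d + h * w * (u * d - w * b)" unfolding 2 by simp
    also have "\<dots> = - h * w ^ 2 * b + (1 + h * u * w) * d" by (simp add: algebra_simps power2_eq_square)
    finally show "e * (h * x ^ 2) + d * (1 + h * x * y) = - h * w ^ 2 * b + (1 + h * u * w) * d" .
  qed
  then have "pm (mat2 a b e d) \<otimes>\<^bsub>PSL2R\<^esub> cusp_elt c h = cusp_elt c' (s ^ 2 * h) \<otimes>\<^bsub>PSL2R\<^esub> pm (mat2 a b e d)"
    unfolding c' by (simp add: cusp_elt_def pm_mult x_def y_def)
  then show ?thesis using det by (simp add: PSL2R.m_assoc)
qed

text \<open>Since \<open>l\<close> is positive, conjugation preserves the sign of the width, so positive powers of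
  generators correspond to positive powers of generators.\<close>

lemma cusp_elt_conjugate:
  assumes "g \<in> carrier PSL2R"
  obtains l where "l > 0"
    "\<And>h. g \<otimes>\<^bsub>PSL2R\<^esub> cusp_elt c h \<otimes>\<^bsub>PSL2R\<^esub> inv\<^bsub>PSL2R\<^esub> g = cusp_elt (act_bd g c) (l * h)"
proof -
  obtain a b e d where g: "g = pm (mat2 a b e d)" and det: "a * d - b * e = 1"
    using PSL2R_cases[OF assms] by metis
  obtain s where "s \<noteq> 0" "a * bd_fst c + b * bd_snd c = s * bd_fst (mat_act_bd (mat2 a b e d) c)"
    "e * bd_fst c + d * bd_snd c = s * bd_snd (mat_act_bd (mat2 a b e d) c)"
    using mat_act_bd_homogeneous[OF det] by blast
  then show ?thesis
    using that[of "s ^ 2"] cusp_elt_conjugate_matrix[OF det] by (simp add: g act_bd_pm)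
qed

text \<open>After a choice of sign the trace is 2. The eigenvalue \<open>s\<close> of the coordinate vector of \<open>c\<close>
  satisfies \<open>s (2 - s) = 1\<close>, hence \<open>s = 1\<close>, which leaves one free parameter.\<close>

lemma parabolic_fixing_is_cusp_elt:
  assumes "parabolic g" "act_bd g c = c"
  obtains h where "h \<noteq> 0" "g = cusp_elt c h"
proof -
  have "g \<in> carrier PSL2R" and tr: "\<bar>Determinants.trace (some_matrix g)\<bar> = 2" and g1: "g \<noteq> \<one>\<^bsub>PSL2R\<^esub>"
    using assms(1) by (auto simp: parabolic_def)
  then obtain A where A: "A \<in> carrier SL2R" "g = pm A" by (auto simp: carrier_PSL2R)
  have nA: "- A \<in> carrier SL2R" "pm (- A) = pm A"
    using A by (auto simp: SL2R_def det_uminus_2 pm_def)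
  have "Determinants.trace (- A) = - Determinants.trace A" by (simp add: Determinants.trace_def sum_negf)
  then have "\<bar>Determinants.trace A\<bar> = 2" using tr some_matrix_pm[of A] A by auto
  then have "Determinants.trace A = 2 \<or> Determinants.trace (- A) = 2"
    using \<open>Determinants.trace (- A) = - Determinants.trace A\<close> by linarith
  then obtain B where B: "B \<in> carrier SL2R" "g = pm B" "Determinants.trace B = 2" using A nA by metis
  define a b e d where "a = B$1$1" and "b = B$1$2" and "e = B$2$1" and "d = B$2$2"
  have Bm: "B = mat2 a b e d" unfolding a_def b_def e_def d_def by (rule mat2_eta)
  have det: "a * d - b * e = 1" using B(1) by (simp add: Bm)
  have ad: "a + d = 2" using B(3) by (simp add: Bm Determinants.trace_def sum_2)
  have fix_c: "mat_act_bd (mat2 a b e d) c = c" using assms(2) by (simp add: B(2) Bm act_bd_pm)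
  have "\<exists>h. g = cusp_elt c h"
  proof (cases c)
    case Infty
    then have e: "e = 0" using fix_c by (auto split: if_splits)
    have "d = 2 - a" using ad by simp
    then have "a * (2 - a) = 1" using det e by simp
    then have "(a - 1)^2 = 0" by (simp add: power2_eq_square algebra_simps)
    then have "a = 1" by simp
    then show ?thesis using ad e by (auto simp: Infty B(2) Bm cusp_elt_def)
  next
    case (Fin x)
    define s where "s = e * x + d"
    have s: "s \<noteq> 0" "a * x + b = x * s" using fix_c by (auto simp: Fin s_def field_simps split: if_splits)
    have "s * (2 - s) = 1"
    proof -
      have "1 = a * s - e * (a * x + b)" using det by (simp add: s_def algebra_simps)
      also have "\<dots> = s * (a - e * x)" unfolding s(2) by (simp add: algebra_simps)
      also have "a - e * x = 2 - s" using ad by (simp add: s_def)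
      finally show ?thesis by simp
    qed
    then have "(s - 1)^2 = 0" by (simp add: power2_eq_square algebra_simps)
    then have "s = 1" by simp
    then have d: "d = 1 - e * x" and a: "a = 1 + e * x" using ad by (simp_all add: s_def)
    have "b = x - a * x" using s(2) \<open>s = 1\<close> by simp
    then have "b = - e * x ^ 2" by (simp add: a power2_eq_square algebra_simps)
    then have "g = cusp_elt c (- e)" by (simp add: Fin B(2) Bm cusp_elt_def a d)
    then show ?thesis by blast
  qed
  then show ?thesis using that g1 cusp_elt_0 by metis
qed

lemma is_cusp_iff:
  assumes "K \<subseteq> carrier PSL2R"
  shows "is_cusp K c \<longleftrightarrow> (\<exists>h. h \<noteq> 0 \<and> cusp_elt c h \<in> K)"
  unfolding is_cusp_def
  by (metis parabolic_fixing_is_cusp_elt parabolic_cusp_elt act_bd_cusp_elt)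

section \<open>Generators of cusp stabilizers in discrete groups\<close>

text \<open>The one-parameter group \<open>h \<mapsto> cusp_elt c h\<close> is continuous, and some neighbourhood of the unit
  contains no further element of \<open>G\<close>.\<close>

lemma discrete_cusp_elt_gap:
  assumes "discrete_subgroup G"
  shows "\<exists>\<epsilon>>0. \<forall>h. 0 < h \<and> cusp_elt c h \<in> G \<longrightarrow> \<epsilon> \<le> h"
proof -
  have G: "subgroup G PSL2R" and disc: "subtopology PSL2R_topology G = discrete_topology G"
    using assms by (auto simp: discrete_subgroup_def)
  have "openin (subtopology PSL2R_topology G) {\<one>\<^bsub>PSL2R\<^esub>}"
    using subgroup.one_closed[OF G] by (simp add: disc)
  then obtain U where U: "openin PSL2R_topology U" "U \<inter> G = {\<one>\<^bsub>PSL2R\<^esub>}"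
    by (auto simp: openin_subtopology)
  then obtain V where V: "open V" "{A \<in> carrier SL2R. pm A \<in> U} = carrier SL2R \<inter> V"
    by (auto simp: openin_PSL2R_topology openin_open)
  define M where "M h = mat2 (1 - h * bd_fst c * bd_snd c) (h * bd_fst c ^ 2)
     (- h * bd_snd c ^ 2) (1 + h * bd_fst c * bd_snd c)" for h
  have M: "M h \<in> carrier SL2R" "cusp_elt c h = pm (M h)" for h
    by (simp_all only: M_def mat2_SL2R cusp_elt_det cusp_elt_def)
  have MV: "M h \<in> V \<longleftrightarrow> cusp_elt c h \<in> U" for h using M V(2) by auto
  have mat2_row: "mat2 a b e d = (\<chi> i j. if i = 1 then (if j = 1 then a else b) else (if j = 1 then e else d))" for a b e d
    by (simp add: Finite_Cartesian_Product.vec_eq_iff forall_2)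
  have "continuous_on UNIV M"
    unfolding M_def[abs_def] mat2_row
    by (intro continuous_on_vec_lambda; rename_tac i j; case_tac "i = 1"; case_tac "j = 1")
      (auto intro!: continuous_intros)
  then have "open (M -` V)" using V(1) by (simp add: continuous_on_open_vimage)
  moreover have "0 \<in> M -` V" using U by (auto simp: MV cusp_elt_0)
  ultimately obtain \<epsilon> where \<epsilon>: "\<epsilon> > 0" "ball 0 \<epsilon> \<subseteq> M -` V" by (meson open_contains_ball)
  have "\<epsilon> \<le> h" if "0 < h" "cusp_elt c h \<in> G" for h
  proof (rule ccontr)
    assume "\<not> \<epsilon> \<le> h"
    then have "h \<in> ball 0 \<epsilon>" using that by simp
    then have "cusp_elt c h \<in> U" using \<epsilon>(2) MV by blast
    then have "cusp_elt c h = cusp_elt c 0" using U(2) that(2) cusp_elt_0 by blast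
    then show False using that(1) by (simp add: cusp_elt_inject)
  qed
  then show ?thesis using \<epsilon>(1) by blast
qed

text \<open>The widths occurring in \<open>K\<close> form a nonzero subgroup of the reals without small positive elements;
  such a subgroup is generated by its least positive element. The gap
  at zero is inherited from the ambient group \<open>G\<close>.\<close>

lemma discrete_cusp_least_width:
  assumes G: "discrete_subgroup G" and K: "subgroup K PSL2R" and KG: "K \<subseteq> G" and c: "is_cusp K c"
  obtains w where "w > 0" "cusp_elt c w \<in> K"
    "\<And>h. h > 0 \<Longrightarrow> cusp_elt c h \<in> K \<Longrightarrow> \<exists>n::nat. n > 0 \<and> h = real n * w"
proof -
  define S where "S = {h. h > 0 \<and> cusp_elt c h \<in> K}"
  have diff: "h - k \<in> S" if "h \<in> S" "k \<in> S" "k < h" for h k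
    using that subgroup.m_closed[OF K, of "cusp_elt c h" "cusp_elt c (- k)"]
      subgroup.m_inv_closed[OF K, of "cusp_elt c k"]
    by (auto simp: S_def cusp_elt_add cusp_elt_inv)
  obtain h where h: "h \<noteq> 0" "cusp_elt c h \<in> K"
    using c is_cusp_iff subgroup.subset[OF K] by blast
  then have "cusp_elt c (- h) \<in> K" using subgroup.m_inv_closed[OF K h(2)] by (simp add: cusp_elt_inv)
  with h have "h \<in> S \<or> - h \<in> S" by (auto simp: S_def)
  then have ne: "S \<noteq> {}" by auto
  obtain \<epsilon> where "\<epsilon> > 0" and gap: "\<And>h. h \<in> S \<Longrightarrow> \<epsilon> \<le> h"
    using discrete_cusp_elt_gap[OF G, of c] KG unfolding S_def by blast
  have bdd: "bdd_below S" by (rule bdd_belowI[of _ 0]) (auto simp: S_def)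
  obtain w where w: "w \<in> S" "w < Inf S + \<epsilon>"
    using cInf_lessD[OF ne, of "Inf S + \<epsilon>"] \<open>\<epsilon> > 0\<close> by auto
  have least: "w \<le> h" if "h \<in> S" for h
  proof (rule ccontr)
    assume "\<not> w \<le> h"
    then have "\<epsilon> \<le> w - h" using gap diff[OF w(1) that] by simp
    moreover have "Inf S \<le> h" using that bdd by (rule cInf_lower)
    ultimately show False using w(2) by simp
  qed
  have w0: "w > 0" "cusp_elt c w \<in> K" using w(1) by (simp_all add: S_def)
  have "\<exists>n::nat. n > 0 \<and> h = real n * w" if "h > 0" "cusp_elt c h \<in> K" for h
  proof -
    define n where "n = nat \<lfloor>h / w\<rfloor>"
    have "w \<le> h" using that least by (simp add: S_def)
    then have 1: "1 \<le> h / w" using w0 by simp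
    then have n: "n > 0" "real n = of_int \<lfloor>h / w\<rfloor>" by (simp_all add: n_def)
    have "real n \<le> h / w" "h / w < real n + 1" using n(2) by linarith+
    then have r: "real n * w \<le> h" "h < real n * w + w"
      using w0 by (simp_all add: pos_le_divide_eq pos_divide_less_eq distrib_right)
    have nK: "real n * w \<in> S"
    proof -
      have "cusp_elt c w [^]\<^bsub>PSL2R\<^esub> k \<in> K" for k :: nat
        by (induction k) (use w0 subgroup.one_closed[OF K] subgroup.m_closed[OF K] in auto)
      then show ?thesis using n(1) w0 by (simp add: S_def cusp_elt_pow)
    qed
    have "h = real n * w"
    proof (rule ccontr)
      assume "h \<noteq> real n * w"
      then have "h - real n * w \<in> S" using diff[of h, OF _ nK] r that by (simp add: S_def)
      then show False using least r by fastforce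
    qed
    then show ?thesis using n by blast
  qed
  then show ?thesis using that w0 by blast
qed

text \<open>The stabilizer of infinity contains no diagonal part: an element with diagonal entries \<open>a\<close> and
  \<open>d = 1/a\<close> conjugates the translation by the least width \<open>w\<close> to the translation by \<open>a\<^sup>2 w\<close>, and
  its inverse gives \<open>d\<^sup>2 w\<close>. Both are at least \<open>w\<close>, so \<open>a\<^sup>2 = 1\<close>.\<close>

lemma cusp_width_Infty:
  assumes K: "subgroup K PSL2R" and w: "w > 0" "cusp_elt Infty w \<in> K"
    and mult: "\<And>h. h > 0 \<Longrightarrow> cusp_elt Infty h \<in> K \<Longrightarrow> \<exists>n::nat. n > 0 \<and> h = real n * w"
  shows "cusp_width K Infty = w"
proof -
  have gen: "generate PSL2R {transl h} = {cusp_elt Infty (of_int k * h) |k. True}" for h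
    by (simp add: transl_eq_cusp_elt PSL2R.generate_pow cusp_elt_int_pow)
  have ge1: "l \<ge> 1" if l: "l > 0" "cusp_elt Infty (l * w) \<in> K" for l
  proof -
    obtain n :: nat where "n > 0" "l * w = real n * w" using mult[of "l * w"] l w by auto
    then show ?thesis using w by simp
  qed
  have stab: "stabilizer (subgrp K) act_bd Infty = generate PSL2R {transl w}"
  proof (intro equalityI subsetI)
    fix g assume "g \<in> generate PSL2R {transl w}"
    then obtain k where g: "g = cusp_elt Infty w [^]\<^bsub>PSL2R\<^esub> (k::int)"
      using gen[of w] by (auto simp: cusp_elt_int_pow)
    have "g \<in> K"
      unfolding g by (rule PSL2R.subgroup_int_pow_closed[OF K w(2)])
    then show "g \<in> stabilizer (subgrp K) act_bd Infty"
      by (simp add: stabilizer_def g cusp_elt_int_pow act_bd_cusp_elt)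
  next
    fix g assume "g \<in> stabilizer (subgrp K) act_bd Infty"
    then have gK: "g \<in> K" and fix_g: "act_bd g Infty = Infty" by (auto simp: stabilizer_def)
    obtain a b e d where g: "g = pm (mat2 a b e d)" and det: "a * d - b * e = 1"
      using PSL2R_cases subgroup.mem_carrier[OF K gK] by metis
    have e: "e = 0" using fix_g by (auto simp: g act_bd_pm split: if_splits)
    have ad: "a * d = 1" using det e by simp
    then have "a \<noteq> 0" "d \<noteq> 0" by auto
    have gi: "inv\<^bsub>PSL2R\<^esub> g \<in> K" using subgroup.m_inv_closed[OF K gK] .
    have "g \<otimes>\<^bsub>PSL2R\<^esub> cusp_elt Infty w \<otimes>\<^bsub>PSL2R\<^esub> inv\<^bsub>PSL2R\<^esub> g \<in> K"
      using gK gi w(2) subgroup.m_closed[OF K] by blast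
    then have "cusp_elt Infty (a ^ 2 * w) \<in> K"
      using cusp_elt_conjugate_matrix[OF det, of Infty a Infty w] e by (simp add: g)
    then have a: "a ^ 2 \<ge> 1" using ge1[of "a ^ 2"] \<open>a \<noteq> 0\<close> by simp
    have "inv\<^bsub>PSL2R\<^esub> g \<otimes>\<^bsub>PSL2R\<^esub> cusp_elt Infty w \<otimes>\<^bsub>PSL2R\<^esub> inv\<^bsub>PSL2R\<^esub> (inv\<^bsub>PSL2R\<^esub> g) \<in> K"
      using gK gi w(2) subgroup.m_closed[OF K] subgroup.m_inv_closed[OF K] by blast
    also have "inv\<^bsub>PSL2R\<^esub> g = pm (mat2 d (- b) (- e) a)" unfolding g by (rule pm_inv[OF det])
    finally have "cusp_elt Infty (d ^ 2 * w) \<in> K"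
      using cusp_elt_conjugate_matrix[of d a "- b" "- e" Infty d Infty w] det e
      by (simp add: mult.commute)
    then have d: "d ^ 2 \<ge> 1" using ge1[of "d ^ 2"] \<open>d \<noteq> 0\<close> by simp
    have "a ^ 2 * d ^ 2 = 1" using ad by (simp flip: power_mult_distrib)
    moreover have "a ^ 2 * 1 \<le> a ^ 2 * d ^ 2" using d by (intro mult_left_mono) auto
    ultimately have "a ^ 2 = 1" using a by simp
    then have "a = 1 \<or> a = - 1" by (simp add: power2_eq_1_iff)
    then have "\<exists>h. g = cusp_elt Infty h"
    proof
      assume "a = 1"
      then have "g = cusp_elt Infty b" using ad e by (simp add: g cusp_elt_def)
      then show ?thesis by blast
    next
      assume "a = - 1"
      then have "g = cusp_elt Infty (- b)" using ad e by (simp add: g cusp_elt_def pm_eq_iff mat2_uminus)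
      then show ?thesis by blast
    qed
    then obtain h where h: "g = cusp_elt Infty h" by blast
    have "\<exists>k::int. h = of_int k * w"
    proof (cases h "0 :: real" rule: linorder_cases)
      case less
      then obtain n :: nat where "- h = real n * w" using mult[of "- h"] gi by (auto simp: h cusp_elt_inv)
      then have "h = of_int (- int n) * w" by simp
      then show ?thesis by blast
    next
      case equal
      then show ?thesis by (intro exI[of _ 0]) simp
    next
      case greater
      then obtain n :: nat where "h = real n * w" using mult[of h] gK by (auto simp: h)
      then have "h = of_int (int n) * w" by simp
      then show ?thesis by blast
    qed
    then show "g \<in> generate PSL2R {transl w}" by (auto simp: gen h)
  qed
  have "h = w" if h: "h > 0" "generate PSL2R {transl h} = generate PSL2R {transl w}" for h
  proof -
    have "cusp_elt Infty h \<in> generate PSL2R {transl w}" "cusp_elt Infty w \<in> generate PSL2R {transl h}"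
      using h(2) generate.incl[of _ "{transl h}" PSL2R] generate.incl[of _ "{transl w}" PSL2R]
      by (auto simp: transl_eq_cusp_elt)
    then have "\<exists>k::int. h = of_int k * w" "\<exists>l::int. w = of_int l * h"
      unfolding gen cusp_elt_inject mem_Collect_eq by simp_all
    then obtain k l :: int where kl: "h = of_int k * w" "w = of_int l * h" by blast
    then have "k > 0" "l > 0" using h(1) w(1) by (metis of_int_0_less_iff zero_less_mult_pos2)+
    then have "1 * w \<le> h" "1 * h \<le> w" using kl h(1) w(1)
      by (metis mult_right_mono of_int_1_le_iff less_imp_le int_one_le_iff_zero_less)+
    then show ?thesis by simp
  qed
  then show ?thesis unfolding cusp_width.simps stab using w(1)
    by (intro the_equality conjI refl) (blast dest: sym)+
qed

lemma cusp_generator: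
  assumes G: "discrete_subgroup G" and K: "subgroup K PSL2R" and KG: "K \<subseteq> G" and c: "is_cusp K c"
  obtains w where "w > 0" "cusp_elt c w \<in> K" "cusp_generator K c = cusp_elt c w"
    "\<And>h. h > 0 \<Longrightarrow> cusp_elt c h \<in> K \<Longrightarrow> \<exists>n::nat. n > 0 \<and> h = real n * w"
proof -
  obtain w where w: "w > 0" "cusp_elt c w \<in> K"
    and mult: "\<And>h. h > 0 \<Longrightarrow> cusp_elt c h \<in> K \<Longrightarrow> \<exists>n::nat. n > 0 \<and> h = real n * w"
    using discrete_cusp_least_width[OF assms] by blast
  have "cusp_generator K c = cusp_elt c w"
  proof (cases c)
    case Infty
    then show ?thesis using cusp_width_Infty[OF K] w mult by (simp add: transl_eq_cusp_elt del: cusp_width.simps)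
  next
    case (Fin x)
    have "w \<le> h" if h: "h > 0 \<and> cusp_elt (Fin x) h \<in> K" for h
    proof -
      obtain n :: nat where n: "n > 0" "h = real n * w" using mult h Fin by blast
      then have "1 * w \<le> real n * w" using w by (intro mult_right_mono) auto
      then show ?thesis using n by simp
    qed
    then have "(LEAST h. h > 0 \<and> cusp_elt (Fin x) h \<in> K) = w"
      using w Fin by (intro Least_equality) auto
    then show ?thesis by (simp add: Fin cusp_transl_eq_cusp_elt)
  qed
  then show ?thesis using that w mult by blast
qed

section \<open>Admissibility of the induced representation\<close>

text \<open>Admissibility constrains \<open>\<rho>\<close> only at infinity and at the representatives in \<open>R\<close>. The other cusps
  follow since an element of \<open>H\<close> moving \<open>c\<close> to its representative conjugates the given element to a
  power of the generator there.\<close>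

lemma admissible_diagonalizable_cusp_elt:
  assumes G: "discrete_subgroup G" and H: "subgroup H PSL2R" and HG: "H \<subseteq> G"
    and R: "cusp_representatives H R" and adm: "admissible H R d \<rho>"
    and h: "h > 0" "cusp_elt c h \<in> H"
  shows "diagonalizable_mat (\<rho> (cusp_elt c h))"
proof -
  have rep: "representation H d \<rho>" using adm by (simp add: admissible_def)
  have Hc: "x \<in> carrier PSL2R" if "x \<in> H" for x using subgroup.mem_carrier[OF H that] .
  have "is_cusp H c" using h is_cusp_iff[OF subgroup.subset[OF H]] by (metis less_irrefl)
  then obtain r where r: "r \<in> R" "r \<in> orbit (subgrp H) act_bd c"
    using R unfolding cusp_representatives_def by blast
  then obtain g where g: "g \<in> H" "r = act_bd g c" by (auto simp: orbit_def)
  have "is_cusp H r" using r R by (simp add: cusp_representatives_def)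
  then obtain w where w: "w > 0" "cusp_elt r w \<in> H" "cusp_generator H r = cusp_elt r w"
    and mult: "\<And>h. h > 0 \<Longrightarrow> cusp_elt r h \<in> H \<Longrightarrow> \<exists>n::nat. n > 0 \<and> h = real n * w"
    using cusp_generator[OF G H HG] by metis
  have gen: "diagonalizable_mat (\<rho> (cusp_elt r w))"
  proof (cases "r = Infty")
    case True
    have "diagonal_mat (\<rho> (cusp_elt r w))"
      using adm w(3) True by (simp add: admissible_def)
    then show ?thesis
      using similar_mat_refl representation_carrier[OF H rep w(2)] unfolding diagonalizable_mat_def by blast
  next
    case False
    then show ?thesis using adm r(1) w(3) by (auto simp: admissible_def)
  qed
  obtain l where l: "l > 0"
    "g \<otimes>\<^bsub>PSL2R\<^esub> cusp_elt c h \<otimes>\<^bsub>PSL2R\<^esub> inv\<^bsub>PSL2R\<^esub> g = cusp_elt r (l * h)"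
    using cusp_elt_conjugate[OF Hc[OF g(1)], of c] g(2) by metis
  have "cusp_elt r (l * h) \<in> H"
    unfolding l(2)[symmetric] using g(1) h(2) subgroup.m_closed[OF H] subgroup.m_inv_closed[OF H] by blast
  then obtain n :: nat where n: "l * h = real n * w" using mult l(1) h(1) by (metis mult_pos_pos)
  have "\<rho> (cusp_elt r (l * h)) = \<rho> (cusp_elt r w) ^\<^sub>m n"
    unfolding n cusp_elt_pow[symmetric] by (rule representation_pow[OF H rep w(2)])
  then have "diagonalizable_mat (\<rho> (cusp_elt r (l * h)))" using diagonalizable_power[OF gen] by simp
  moreover have "similar_mat (\<rho> (cusp_elt c h)) (\<rho> (cusp_elt r (l * h)))"
    using representation_conjugate_similar[OF H rep h(2) g(1)] l(2) similar_mat_sym by metis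
  ultimately show ?thesis using diagonalizable_mat_similar by blast
qed

lemma (in induced) induced_cusp_generator_diagonalizable:
  assumes disc: "discrete_subgroup G" and R: "cusp_representatives H R" and adm: "admissible H R d \<rho>"
    and c: "is_cusp G c"
  shows "cusp_generator G c \<in> G"
    "diagonalizable_mat (induced_representation H d m \<gamma> \<rho> (cusp_generator G c))"
proof -
  let ?\<rho>' = "induced_representation H d m \<gamma> \<rho>"
  obtain w where w: "w > 0" "cusp_elt c w \<in> G" "cusp_generator G c = cusp_elt c w"
    using cusp_generator[OF disc G subset_refl c] by metis
  show "cusp_generator G c \<in> G" using w by simp
  obtain N :: nat where N: "N > 0"
    "\<And>i. i < m \<Longrightarrow> inv\<^bsub>PSL2R\<^esub> (\<gamma> i) \<otimes>\<^bsub>PSL2R\<^esub> cusp_elt c (N * w) \<otimes>\<^bsub>PSL2R\<^esub> \<gamma> i \<in> H"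
    using common_power_conjugate_in_subgroup[OF w(2)] by (auto simp: cusp_elt_pow)
  have power: "cusp_elt c (N * w) \<in> G" "?\<rho>' (cusp_elt c (N * w)) = ?\<rho>' (cusp_elt c w) ^\<^sub>m N"
    using representation_pow[OF G representation_induced w(2), of N] by (simp_all add: cusp_elt_pow)
  have "diagonalizable_mat (?\<rho>' (cusp_elt c (N * w)))"
  proof (subst induced_block_diag[OF power(1)])
    show "inv\<^bsub>PSL2R\<^esub> (\<gamma> i) \<otimes>\<^bsub>PSL2R\<^esub> cusp_elt c (N * w) \<otimes>\<^bsub>PSL2R\<^esub> \<gamma> i \<in> H" if "i < m" for i
      by (rule N(2)[OF that])
  next
    show "diagonalizable_mat (block_diag d m
      (\<lambda>i. \<rho> (inv\<^bsub>PSL2R\<^esub> (\<gamma> i) \<otimes>\<^bsub>PSL2R\<^esub> cusp_elt c (N * w) \<otimes>\<^bsub>PSL2R\<^esub> \<gamma> i)))"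
    proof (rule diagonalizable_block_diag)
      fix i assume i: "i < m"
      show "\<rho> (inv\<^bsub>PSL2R\<^esub> (\<gamma> i) \<otimes>\<^bsub>PSL2R\<^esub> cusp_elt c (N * w) \<otimes>\<^bsub>PSL2R\<^esub> \<gamma> i) \<in> carrier_mat d d"
        by (rule representation_carrier[OF H rep N(2)[OF i]])
      have g: "\<gamma> i \<in> carrier PSL2R" using i gamma_G G_carrier by blast
      obtain l where l: "l > 0" "inv\<^bsub>PSL2R\<^esub> (\<gamma> i) \<otimes>\<^bsub>PSL2R\<^esub> cusp_elt c (N * w) \<otimes>\<^bsub>PSL2R\<^esub> \<gamma> i
          = cusp_elt (act_bd (inv\<^bsub>PSL2R\<^esub> (\<gamma> i)) c) (l * (N * w))"
        using cusp_elt_conjugate[of "inv\<^bsub>PSL2R\<^esub> (\<gamma> i)" c] g by (metis PSL2R.inv_closed PSL2R.inv_inv)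
      then show "diagonalizable_mat (\<rho> (inv\<^bsub>PSL2R\<^esub> (\<gamma> i) \<otimes>\<^bsub>PSL2R\<^esub> cusp_elt c (N * w) \<otimes>\<^bsub>PSL2R\<^esub> \<gamma> i))"
        using admissible_diagonalizable_cusp_elt[OF disc H HG R adm] N(1) N(2)[OF i] w(1)
        by (metis mult_pos_pos of_nat_0_less_iff)
    qed
  qed
  then show "diagonalizable_mat (?\<rho>' (cusp_generator G c))"
    using diagonalizable_if_power_diagonalizable[OF representation_carrier[OF G representation_induced w(2)]
        representation_carrier[OF G representation_induced subgroup.m_inv_closed[OF G w(2)]]
        representation_inv(1)[OF G representation_induced w(2)] N(1)] power(2) w(3) by simp
qed

theorem theorem4p2:
  fixes G H :: "(real^2^2) set set"
    and m d :: nat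
    and \<gamma> :: "nat \<Rightarrow> (real^2^2) set"
    and \<rho> :: "(real^2^2) set \<Rightarrow> complex mat"
    and R\<^sub>G R\<^sub>H :: "bdpoint set"
  assumes "fuchsian_first_kind G"
    and "is_cusp G Infty"
    and "subgroup H (subgrp G)"
    and "finite (lcosets\<^bsub>subgrp G\<^esub> H)"
    and "card (lcosets\<^bsub>subgrp G\<^esub> H) = m"
    and "left_transversal G H m \<gamma>"
    and "cusp_representatives G R\<^sub>G"
    and "cusp_representatives H R\<^sub>H"
    and "admissible H R\<^sub>H d \<rho>"
  shows "\<exists>\<sigma>. equivalent_representations G (induced_representation H d m \<gamma> \<rho>) \<sigma> \<and>
             admissible G R\<^sub>G (d * m) \<sigma>"
proof -
  have disc: "discrete_subgroup G" using assms(1) by (simp add: fuchsian_first_kind_def)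
  then have G: "subgroup G PSL2R" by (simp add: discrete_subgroup_def)
  interpret induced G H m d \<gamma> \<rho>
  proof (rule induced.intro)
    show "subgroup G PSL2R" by fact
    show "subgroup H PSL2R" by (rule PSL2R.incl_subgroup[OF G assms(3)])
    show "H \<subseteq> G" using subgroup.subset[OF assms(3)] by simp
    show "left_transversal G H m \<gamma>" by fact
    show "representation H d \<rho>" using assms(9) by (simp add: admissible_def)
  qed
  let ?\<rho>' = "induced_representation H d m \<gamma> \<rho>"
  note cusp = induced_cusp_generator_diagonalizable[OF disc assms(8,9)]
  note carrier = representation_carrier[OF G representation_induced]
  obtain D P Q where D: "diagonal_mat D"
    and sim: "similar_mat_wit (?\<rho>' (cusp_generator G Infty)) D P Q"
    using cusp(2)[OF assms(2)] unfolding diagonalizable_mat_def similar_mat_def by blast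
  note s = similar_mat_witD2[OF carrier[OF cusp(1)[OF assms(2)]] sim]
  define \<sigma> where "\<sigma> = (\<lambda>x. Q * ?\<rho>' x * P)"
  have rep_\<sigma>: "representation G (d * m) \<sigma>"
    and sim_\<sigma>: "\<And>x. x \<in> G \<Longrightarrow> similar_mat_wit (?\<rho>' x) (\<sigma> x) P Q"
    using equivalent_representation[OF G representation_induced s(6,7,1,2)] by (simp_all add: \<sigma>_def)
  have "\<sigma> (cusp_generator G Infty) = D"
    unfolding \<sigma>_def using similar_mat_witD(3)[OF refl similar_mat_wit_sym[OF sim]] by simp
  moreover have "diagonalizable_mat (\<sigma> (cusp_generator G c))" if "c \<in> R\<^sub>G" for c
  proof -
    have c: "is_cusp G c" using that assms(7) by (simp add: cusp_representatives_def)
    have "similar_mat (\<sigma> (cusp_generator G c)) (?\<rho>' (cusp_generator G c))"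
      using sim_\<sigma>[OF cusp(1)[OF c]] similar_mat_sym unfolding similar_mat_def by blast
    then show ?thesis using cusp(2)[OF c] by (rule diagonalizable_mat_similar)
  qed
  ultimately have "admissible G R\<^sub>G (d * m) \<sigma>" using rep_\<sigma> D by (simp add: admissible_def del: cusp_generator.simps)
  moreover have "equivalent_representations G ?\<rho>' \<sigma>"
    using sim_\<sigma> unfolding equivalent_representations_def by blast
  ultimately show ?thesis by blast
qed

end
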